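(* Let $p\ge2$ be an integer. Let $(x_n)_{n\ge1}$ and $(y_n)_{n\ge1}$ be sequences of distinct points on $\mathbb{S}^{p-1}$, and set $\mathcal{X}_n=\{x_1,\dots,x_n\}$, $\mathcal{Y}_n=\{y_1,\dots,y_n\}$, $\mathcal{X}_\infty=\{x_n:n\ge1\}$, $\mathcal{Y}_\infty=\{y_n:n\ge1\}$. For each $n$, let $f_n:\mathcal{X}_n\to\mathbb{S}^{p-1}$ and $g_n:\mathcal{Y}_n\to\mathbb{S}^{p-1}$ satisfy $$\langle x,y\rangle<\langle x,y'\rangle \implies \langle f_n(x),g_n(y)\rangle\le\langle f_n(x),g_n(y')\rangle \qquad\text{for all } (x,y,y')\in\mathcal{X}_n\times\mathcal{Y}_n\times\mathcal{Y}_n.$$ Then $((f_n,g_n))_{n\ge 1}$ is sequentially compact for the pointwise convergence topology. Assume further that $\mathcal{X}_\infty$ is dense in a non-empty open subset of $\mathbb{S}^{p-1}$ and that $\mathcal{Y}_\infty$ is dense in $\mathbb{S}^{p-1}$. If $p=2$, assume in addition that $\mathcal{X}_\infty$ is dense in an open set containing a closed hemisphere. Then, if $(f,g)$, with $f:\mathcal{X}_\infty\to\mathbb{S}^{p-1}$ and $g:\mathcal{Y}_\infty\to\mathbb{S}^{p-1}$, denotes an accumulation point of $((f_n,g_n))$ such that $g(\mathcal{Y}_\infty)$ is dense in $\mathbb{S}^{p-1}$, the functions $f$ and $g$ must coincide with the same orthogonal transformation of $\mathbb{R}^p$ on $\mathcal{X}_\infty$ and $\mathcal{Y}_\infty$,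 respectively.
   Context: $\mathbb{S}^{p-1} = \{x\in\mathbb{R}^p : \|x\|=1\}$ with the topology induced from $\mathbb{R}^p$; $\langle\cdot,\cdot\rangle$ is the Euclidean inner product. A closed hemisphere is a set $\{x\in\mathbb{S}^{p-1} : \langle x,u\rangle\ge 0\}$ for some $u \in \mathbb{S}^{p-1}$. A set is dense in an open set $U\subset\mathbb{S}^{p-1}$ if its closure contains $U$. Each $x_i$ (resp. $y_i$) is in the domain of $f_n$ (resp. $g_n$) for all $n\ge i$. An accumulation point of $((f_n,g_n))$ is a pair $(f,g)$ for which there is a subsequence $(n_k)$ with $f_{n_k}(x)\to f(x)$ for all $x\in\mathcal{X}_\infty$ and $g_{n_k}(y)\to g(y)$ for all $y\in\mathcal{Y}_\infty$; sequential compactness means that every subsequence of $((f_n,g_n))$ has a further subsequence converging pointwise in this sense. *)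

theory Defs
  imports "HOL-Analysis.Analysis"
begin

text \<open>
  Sequences are indexed by the integers \<open>n \<ge> 1\<close>; values at index \<open>0\<close> are irrelevant.
  A function with domain \<open>A\<close> is represented by a total function whose values outside \<open>A\<close> are
  never constrained.
\<close>

abbreviation unit_sphere :: "(real ^ 'p) set" where
  "unit_sphere \<equiv> sphere 0 1"

definition closed_hemisphere :: "real ^ 'p \<Rightarrow> (real ^ 'p) set" where
  "closed_hemisphere u = {x \<in> unit_sphere. x \<bullet> u \<ge> 0}"

definition open_in_sphere :: "(real ^ 'p) set \<Rightarrow> bool" where
  "open_in_sphere U \<longleftrightarrow> openin (top_of_set unit_sphere) U"

text \<open>
  For subsets \<open>A\<close> of the sphere the closure in the ambient space is the closure in the sphere, since
  the sphere is closed. The set \<open>A\<close> need not be contained in \<open>U\<close>.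
\<close>
definition dense_in :: "(real ^ 'p) set \<Rightarrow> (real ^ 'p) set \<Rightarrow> bool" where
  "dense_in A U \<longleftrightarrow> U \<subseteq> closure A"

definition subseq_indices :: "(nat \<Rightarrow> nat) \<Rightarrow> bool" where
  "subseq_indices r \<longleftrightarrow> strict_mono r \<and> (\<forall>k. r k \<ge> 1)"

text \<open>
  In the intended use \<open>F n\<close> has the domain \<open>{x\<^sub>1, \<dots>, x\<^sub>n}\<close>, so at each point of
  \<open>X = {x\<^sub>1, x\<^sub>2, \<dots>}\<close> only finitely many terms of the sequence below are evaluated
  outside their domain; these do not affect the limit. Likewise for \<open>G\<close> and \<open>Y\<close>.
\<close>
definition pointwise_convergent_to ::
  "(real ^ 'p) set \<Rightarrow> (real ^ 'p) set \<Rightarrow>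
   (nat \<Rightarrow> real ^ 'p \<Rightarrow> real ^ 'p) \<Rightarrow> (nat \<Rightarrow> real ^ 'p \<Rightarrow> real ^ 'p) \<Rightarrow>
   (real ^ 'p \<Rightarrow> real ^ 'p) \<Rightarrow> (real ^ 'p \<Rightarrow> real ^ 'p) \<Rightarrow> bool" where
  "pointwise_convergent_to X Y F G f g \<longleftrightarrow>
     (\<forall>x\<in>X. (\<lambda>k. F k x) \<longlonglongrightarrow> f x) \<and> (\<forall>y\<in>Y. (\<lambda>k. G k y) \<longlonglongrightarrow> g y)"

definition accumulation_point ::
  "(real ^ 'p) set \<Rightarrow> (real ^ 'p) set \<Rightarrow>
   (nat \<Rightarrow> real ^ 'p \<Rightarrow> real ^ 'p) \<Rightarrow> (nat \<Rightarrow> real ^ 'p \<Rightarrow> real ^ 'p) \<Rightarrow>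
   (real ^ 'p \<Rightarrow> real ^ 'p) \<Rightarrow> (real ^ 'p \<Rightarrow> real ^ 'p) \<Rightarrow> bool" where
  "accumulation_point X Y F G f g \<longleftrightarrow>
     f \<in> X \<rightarrow> unit_sphere \<and> g \<in> Y \<rightarrow> unit_sphere \<and>
     (\<exists>r. subseq_indices r \<and> pointwise_convergent_to X Y (F \<circ> r) (G \<circ> r) f g)"

definition pointwise_sequentially_compact ::
  "(real ^ 'p) set \<Rightarrow> (real ^ 'p) set \<Rightarrow>
   (nat \<Rightarrow> real ^ 'p \<Rightarrow> real ^ 'p) \<Rightarrow> (nat \<Rightarrow> real ^ 'p \<Rightarrow> real ^ 'p) \<Rightarrow> bool" where
  "pointwise_sequentially_compact X Y F G \<longleftrightarrow>
     (\<forall>r. subseq_indices r \<longrightarrow>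
       (\<exists>s f g. strict_mono s \<and> f \<in> X \<rightarrow> unit_sphere \<and> g \<in> Y \<rightarrow> unit_sphere \<and>
         pointwise_convergent_to X Y (F \<circ> r \<circ> s) (G \<circ> r \<circ> s) f g))"

end

(*
For x in X the function y |-> <f x, g y> is, up to jumps, a nondecreasing function phi_x of <x, y>.
Integrating phi_x(<x, z> / |z|) z over the unit ball gives a positive multiple lambda_x x of x, because
the integrand is equivariant under the isometries fixing x. For almost every z all the phi_x involved
are continuous at <x, z> / |z|, and there phi_x is linear in f x. So a linear dependency
sum c_x f x = 0 forces sum c_x lambda_x x = 0, and therefore f x = lambda_x B x on X for an injective
linear map B.

Put k = B^T g. Then <x, y> < <x, y'> implies <x, k y> <= <x, k y'> for all x in an open cone, so
k y - k y' = c (y - y') with c >= 0 whenever y - y' is orthogonal to a point of the cone. Since no three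
points of a sphere are collinear, c is the same for the three sides of a triangle, and k y = c y + d
first near a point of the cone, then on all of Y by repeated reflections in lines of the cone. So
g is affine on Y; an affine bijection mapping the sphere into itself is orthogonal, and c (B^T)^(-1) is
the required transformation.
*)
theory Submission
  imports Defs "HOL-Complex_Analysis.Great_Picard"
begin

section \<open>Invariance of Lebesgue measure under orthogonal transformations\<close>

lemma nn_integral_lborel_shift:
  fixes h :: "'a::euclidean_space \<Rightarrow> ennreal"
  assumes [measurable]: "h \<in> borel_measurable borel"
  shows "(\<integral>\<^sup>+x. h (a + x) \<partial>lborel) = (\<integral>\<^sup>+x. h x \<partial>lborel)"
proof -
  have "(\<integral>\<^sup>+x. h x \<partial>lborel) = (\<integral>\<^sup>+x. h x \<partial>distr lborel borel ((+) a))"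
    by (simp add: lborel_distr_plus)
  then show ?thesis
    by (simp add: nn_integral_distr)
qed

lemma nn_integral_lborel_reflect:
  fixes h :: "'a::euclidean_space \<Rightarrow> ennreal"
  assumes [measurable]: "h \<in> borel_measurable borel"
  shows "(\<integral>\<^sup>+x. h (a - x) \<partial>lborel) = (\<integral>\<^sup>+x. h x \<partial>lborel)"
proof -
  have "(lborel :: 'a measure) = distr lborel borel (\<lambda>x. a - x)"
    using lborel_affine[of "-1" a] by (simp add: density_1)
  then have "(\<integral>\<^sup>+x. h x \<partial>lborel) = (\<integral>\<^sup>+x. h x \<partial>distr lborel borel (\<lambda>x. a - x))"
    by simp
  then show ?thesis
    by (simp add: nn_integral_distr)
qed

text \<open>The image measure is translation invariant, so Fubini's theorem makes it proportional to
  Lebesgue measure; the unit ball, being invariant, fixes the constant.\<close>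
lemma lborel_distr_orthogonal_transformation:
  fixes R :: "'a::euclidean_space \<Rightarrow> 'a"
  assumes R: "orthogonal_transformation R"
  shows "distr lborel borel R = lborel"
proof (rule measure_eqI)
  fix A :: "'a set"
  assume "A \<in> sets (distr lborel borel R)"
  then have A[measurable]: "A \<in> sets borel" by simp
  have lin: "linear R" and "bij R"
    using R by (auto simp: orthogonal_transformation_linear orthogonal_transformation_bij)
  have [measurable]: "R \<in> borel_measurable borel"
    using lin by (intro borel_measurable_continuous_onI linear_continuous_on) (simp add: linear_linear)
  have norm_R: "norm (R z) = norm z" for z
    using R by (rule orthogonal_transformation_norm)
  let ?B = "cball (0::'a) 1"
  have [measurable]: "?B \<in> sets borel"
    by simp
  have R_inv: "R (inv R x) = x" for x
    using \<open>bij R\<close> by (simp add: bij_is_surj surj_f_inv_f)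
  have eA: "emeasure (distr lborel borel R) A = (\<integral>\<^sup>+y. indicator A (R y) \<partial>lborel)"
    using nn_integral_distr[of R lborel borel "indicator A"] by simp
  have eB: "(\<integral>\<^sup>+y. indicator ?B (R y) \<partial>lborel) = emeasure lborel ?B"
  proof -
    have "(indicator ?B (R y) :: ennreal) = indicator ?B y" for y
      by (simp add: norm_R indicator_def)
    then show ?thesis
      by simp
  qed
  have "emeasure lborel ?B * emeasure (distr lborel borel R) A
      = (\<integral>\<^sup>+y. indicator A (R y) * emeasure lborel ?B \<partial>lborel)"
    by (simp add: eA nn_integral_multc mult.commute)
  also have "\<dots> = (\<integral>\<^sup>+y. indicator A (R y) * (\<integral>\<^sup>+x. indicator ?B (R y + x) \<partial>lborel) \<partial>lborel)"
    by (subst nn_integral_lborel_shift) auto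
  also have "\<dots> = (\<integral>\<^sup>+y. \<integral>\<^sup>+x. indicator A (R y) * indicator ?B (R y + x) \<partial>lborel \<partial>lborel)"
    by (subst nn_integral_cmult) auto
  also have "\<dots> = (\<integral>\<^sup>+x. \<integral>\<^sup>+y. indicator A (R y) * indicator ?B (R y + x) \<partial>lborel \<partial>lborel)"
    by (rule lborel_pair.Fubini') measurable
  \<comment> \<open>For fixed \<open>x\<close>, translating \<open>y\<close> by
    \<open>- inv R x\<close> replaces \<open>R y\<close> by \<open>R y - x\<close>. After a second
    exchange of the integrals the inner one is the measure of \<open>A\<close>.\<close>
  also have "\<dots> = (\<integral>\<^sup>+x. \<integral>\<^sup>+y. indicator A (R y - x) * indicator ?B (R y) \<partial>lborel \<partial>lborel)"
  proof (rule nn_integral_cong)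
    fix x :: 'a
    have "(\<integral>\<^sup>+y. indicator A (R y) * indicator ?B (R y + x) \<partial>lborel)
        = (\<integral>\<^sup>+y. indicator A (R (- inv R x + y)) * indicator ?B (R (- inv R x + y) + x) \<partial>lborel)"
      by (subst nn_integral_lborel_shift) auto
    moreover have "R (- inv R x + y) = R y - x" for y
      by (simp add: linear_diff[OF lin] linear_neg[OF lin] R_inv linear_add[OF lin])
    ultimately show "(\<integral>\<^sup>+y. indicator A (R y) * indicator ?B (R y + x) \<partial>lborel)
        = (\<integral>\<^sup>+y. indicator A (R y - x) * indicator ?B (R y) \<partial>lborel)"
      by simp
  qed
  also have "\<dots> = (\<integral>\<^sup>+y. \<integral>\<^sup>+x. indicator A (R y - x) * indicator ?B (R y) \<partial>lborel \<partial>lborel)"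
    by (rule lborel_pair.Fubini'[symmetric]) measurable
  also have "\<dots> = (\<integral>\<^sup>+y. emeasure lborel A * indicator ?B (R y) \<partial>lborel)"
    by (subst nn_integral_multc) (auto simp: nn_integral_lborel_reflect)
  also have "\<dots> = emeasure lborel ?B * emeasure lborel A"
    by (subst nn_integral_cmult) (auto simp: eB mult.commute)
  finally have *: "emeasure lborel ?B * emeasure (distr lborel borel R) A
      = emeasure lborel ?B * emeasure lborel A" .
  have "emeasure lborel ?B \<noteq> 0" "emeasure lborel ?B < \<infinity>"
    by (auto simp: emeasure_cball unit_ball_vol_pos[THEN less_imp_neq] ennreal_eq_0_iff not_le)
  then show "emeasure (distr lborel borel R) A = emeasure lborel A"
    using * by (auto simp: ennreal_mult_cancel_left)
qed simp

lemma integral_lborel_orthogonal_transformation: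
  fixes h :: "'a::euclidean_space \<Rightarrow> 'b::{banach, second_countable_topology}"
    and R :: "'a \<Rightarrow> 'a"
  assumes "orthogonal_transformation R" "h \<in> borel_measurable borel"
  shows "(\<integral>z. h (R z) \<partial>lborel) = (\<integral>z. h z \<partial>lborel)"
proof -
  have "R \<in> borel_measurable borel"
    using orthogonal_transformation_linear[OF assms(1)]
    by (intro borel_measurable_continuous_onI linear_continuous_on) (simp add: linear_linear)
  then have "(\<integral>z. h (R z) \<partial>lborel) = (\<integral>z. h z \<partial>distr lborel borel R)"
    using assms(2) by (subst integral_distr) auto
  then show ?thesis
    by (simp add: lborel_distr_orthogonal_transformation[OF assms(1)])
qed

section \<open>Zonal integrals over the unit ball\<close>

text \<open>For \<open>t > 0\<close> the cone lies in the frontier of the convex set of all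
  \<open>z\<close> with \<open>t * norm z \<le> x \<bullet> z\<close>, and frontiers of convex sets
  are negligible. The case \<open>t = 0\<close> is a hyperplane, and \<open>t < 0\<close> reduces to
  \<open>t > 0\<close> by negating \<open>x\<close>.\<close>

lemma negligible_circular_cone:
  fixes x :: "'a::euclidean_space"
  assumes "norm x = 1" "DIM('a) \<ge> 2"
  shows "negligible {z. x \<bullet> z = t * norm z}"
proof -
  have pos: "negligible {z. x \<bullet> z = t * norm z}" if "t > 0" "norm x = 1" for t and x :: 'a
  proof -
    define K where "K = {z. t * norm z \<le> x \<bullet> z}"
    have "convex K"
      unfolding K_def convex_def
    proof clarify
      fix a b :: 'a and u v :: real
      assume H: "t * norm a \<le> x \<bullet> a" "t * norm b \<le> x \<bullet> b" "0 \<le> u" "0 \<le> v"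
      have "t * norm (u *\<^sub>R a + v *\<^sub>R b) \<le> t * (norm (u *\<^sub>R a) + norm (v *\<^sub>R b))"
        using \<open>t > 0\<close> by (intro mult_left_mono norm_triangle_ineq) auto
      also have "\<dots> = u * (t * norm a) + v * (t * norm b)"
        using H by (simp add: algebra_simps)
      also have "\<dots> \<le> u * (x \<bullet> a) + v * (x \<bullet> b)"
        using H by (intro add_mono mult_left_mono) auto
      finally show "t * norm (u *\<^sub>R a + v *\<^sub>R b) \<le> x \<bullet> (u *\<^sub>R a + v *\<^sub>R b)"
        by (simp add: inner_add_right)
    qed
    moreover have "{z. x \<bullet> z = t * norm z} \<subseteq> frontier K"
    proof clarify
      fix z assume z: "x \<bullet> z = t * norm z"
      obtain w :: 'a where w: "w \<noteq> 0" "orthogonal x w"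
        using assms(2) orthogonal_to_vector_exists by blast
      \<comment> \<open>The sign makes \<open>z\<close> longer when it moves along \<open>v\<close>,
        while \<open>x \<bullet> z\<close> stays the same because \<open>v\<close> is orthogonal to
        \<open>x\<close>. Arbitrarily small moves therefore leave \<open>K\<close>.\<close>
      define v where "v = (if w \<bullet> z \<ge> 0 then w else - w)"
      have v: "v \<noteq> 0" "x \<bullet> v = 0" "z \<bullet> v \<ge> 0"
        using w by (auto simp: v_def orthogonal_def inner_commute)
      have "z \<notin> interior K"
      proof
        assume "z \<in> interior K"
        then obtain e where e: "e > 0" "ball z e \<subseteq> K"
          by (meson mem_interior)
        define \<epsilon> where "\<epsilon> = e / (2 * norm v)"
        have \<epsilon>: "\<epsilon> > 0" "norm (\<epsilon> *\<^sub>R v) < e"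
          using e v by (auto simp: \<epsilon>_def)
        then have "z + \<epsilon> *\<^sub>R v \<in> K"
          using e by (auto simp: dist_norm subset_iff)
        then have "t * norm (z + \<epsilon> *\<^sub>R v) \<le> t * norm z"
          using v z by (simp add: K_def inner_add_right)
        then have "norm (z + \<epsilon> *\<^sub>R v) \<le> norm z"
          using \<open>t > 0\<close> by simp
        then have "(norm (z + \<epsilon> *\<^sub>R v))\<^sup>2 \<le> (norm z)\<^sup>2"
          by (simp add: power_mono)
        moreover have "(norm (z + \<epsilon> *\<^sub>R v))\<^sup>2 = (norm z)\<^sup>2 + 2 * \<epsilon> * (z \<bullet> v) + \<epsilon>\<^sup>2 * (v \<bullet> v)"
          unfolding power2_norm_eq_inner by (simp add: inner_add inner_commute power2_eq_square)
        moreover have "\<epsilon>\<^sup>2 * (v \<bullet> v) > 0"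
          using v \<epsilon> by simp
        ultimately show False
          using v(3) \<epsilon>(1) by (smt (verit) mult_nonneg_nonneg)
      qed
      moreover have "z \<in> closure K"
        using z by (intro closure_subset[THEN subsetD]) (simp add: K_def)
      ultimately show "z \<in> frontier K"
        by (simp add: frontier_def)
    qed
    ultimately show ?thesis
      using negligible_convex_frontier negligible_subset by blast
  qed
  consider "t > 0" | "t = 0" | "t < 0" by linarith
  then show ?thesis
  proof cases
    case 1 then show ?thesis using pos assms by blast
  next
    case 2
    then show ?thesis
      using assms(1) negligible_hyperplane[of x 0] by force
  next
    case 3
    have "x \<bullet> z = t * norm z \<longleftrightarrow> (-x) \<bullet> z = (-t) * norm z" for z by auto
    then show ?thesis
      using pos[of "-t" "-x"] 3 assms by simp
  qed
qed

text \<open>The integral is fixed by the reflection in the line through \<open>x\<close>, which leaves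
  \<open>x \<bullet> z\<close> and \<open>norm z\<close> unchanged.\<close>
lemma zonal_integral_parallel:
  fixes x :: "'a::euclidean_space" and \<phi> :: "real \<Rightarrow> real"
  assumes x: "norm x = 1" and [measurable]: "\<phi> \<in> borel_measurable borel"
    and bnd: "\<And>t. \<bar>\<phi> t\<bar> \<le> 1"
  defines "h \<equiv> \<lambda>z. (indicator (cball 0 1) z * \<phi> (x \<bullet> z / norm z)) *\<^sub>R z"
  shows "integrable lborel h" and "integral\<^sup>L lborel h = (\<integral>z. x \<bullet> h z \<partial>lborel) *\<^sub>R x"
proof -
  have [measurable]: "(\<lambda>z. indicator (cball 0 1) z :: real) \<in> borel_measurable (borel :: 'a measure)"
    by (auto intro!: borel_measurable_indicator)
  have [measurable]: "h \<in> borel_measurable borel"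
    unfolding h_def by measurable
  show int: "integrable lborel h"
  proof (rule Bochner_Integration.integrable_bound)
    show "integrable lborel (indicator (cball (0::'a) 1) :: 'a \<Rightarrow> real)"
      using emeasure_lborel_cball_finite[of "0::'a" 1] by (intro integrable_real_indicator) auto
    have "norm (h z) \<le> norm (indicator (cball (0::'a) 1) z :: real)" for z
      using mult_mono[OF bnd, of "norm z" 1] by (auto simp: h_def indicator_def)
    then show "AE z in lborel. norm (h z) \<le> norm (indicator (cball (0::'a) 1) z :: real)"
      by simp
  qed simp
  define R where "R = (\<lambda>z. (2 * (x \<bullet> z)) *\<^sub>R x - z)"
  have xx: "x \<bullet> x = 1"
    using x by (simp add: norm_eq_1)
  have "linear R"
    by (rule linearI) (auto simp: R_def algebra_simps inner_add_right scaleR_add_left)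
  have "R z \<bullet> R z = z \<bullet> z" for z
    by (simp add: R_def inner_diff inner_commute xx)
  then have norm_R: "norm (R z) = norm z" for z
    by (simp add: norm_eq_sqrt_inner)
  then have R: "orthogonal_transformation R"
    using \<open>linear R\<close> by (simp add: orthogonal_transformation)
  have "x \<bullet> R z = x \<bullet> z" for z
    by (simp add: R_def inner_diff_right xx)
  then have hR: "h (R z) = (2 * (x \<bullet> h z)) *\<^sub>R x - h z" for z
    by (simp add: h_def norm_R indicator_def) (simp add: R_def scaleR_diff_right)
  have "integral\<^sup>L lborel h = (\<integral>z. h (R z) \<partial>lborel)"
    using R by (rule integral_lborel_orthogonal_transformation[symmetric]) simp
  also have "\<dots> = (\<integral>z. (2 * (x \<bullet> h z)) *\<^sub>R x - h z \<partial>lborel)"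
    by (simp only: hR)
  also have "\<dots> = (2 * (\<integral>z. x \<bullet> h z \<partial>lborel)) *\<^sub>R x - integral\<^sup>L lborel h"
    using int by (subst Bochner_Integration.integral_diff) auto
  finally have "2 *\<^sub>R integral\<^sup>L lborel h = 2 *\<^sub>R ((\<integral>z. x \<bullet> h z \<partial>lborel) *\<^sub>R x)"
    by (simp add: scaleR_2 algebra_simps flip: scaleR_scaleR)
  then show "integral\<^sup>L lborel h = (\<integral>z. x \<bullet> h z \<partial>lborel) *\<^sub>R x"
    by (rule scaleR_left_imp_eq[rotated]) simp
qed

text \<open>Averaging over \<open>z\<close> and \<open>- z\<close> turns the integrand into the odd
  part of \<open>\<phi>\<close> times \<open>x \<bullet> z\<close>. Both factors have the same sign
  because \<open>\<phi>\<close> is monotone, and the product is positive on an open set.\<close>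

lemma zonal_integral_pos:
  fixes x :: "'a::euclidean_space" and \<phi> :: "real \<Rightarrow> real"
  assumes x: "norm x = 1" and "mono \<phi>" and bnd: "\<And>t. \<bar>\<phi> t\<bar> \<le> 1"
    and t0: "0 < t0" "t0 < 1" "\<phi> (- t0) < \<phi> t0"
  defines "h \<equiv> \<lambda>z. (indicator (cball 0 1) z * \<phi> (x \<bullet> z / norm z)) *\<^sub>R z"
  shows "(\<integral>z. x \<bullet> h z \<partial>lborel) > 0"
proof -
  have [measurable]: "\<phi> \<in> borel_measurable borel"
    using \<open>mono \<phi>\<close> by (rule borel_measurable_mono)
  have [measurable]: "(\<lambda>z. indicator (cball 0 1) z :: real) \<in> borel_measurable (borel :: 'a measure)"
    by (auto intro!: borel_measurable_indicator)
  have [measurable]: "h \<in> borel_measurable borel"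
    unfolding h_def by measurable
  have int: "integrable lborel h"
    unfolding h_def by (rule zonal_integral_parallel) (use x bnd in auto)
  have int': "integrable lborel (\<lambda>z. h (- z))"
  proof -
    have "integrable (distr lborel borel uminus) h"
      using int lborel_distr_orthogonal_transformation[of "uminus :: 'a \<Rightarrow> 'a"]
      by (simp add: orthogonal_transformation_neg[of id, simplified] orthogonal_transformation_id id_def)
    then show ?thesis
      by (subst (asm) integrable_distr_eq) auto
  qed
  have refl: "(\<integral>z. x \<bullet> h (- z) \<partial>lborel) = (\<integral>z. x \<bullet> h z \<partial>lborel)"
    by (rule integral_lborel_orthogonal_transformation)
       (auto simp: orthogonal_transformation_def linear_uminus)
  define H where "H = (\<lambda>z. x \<bullet> h z + x \<bullet> h (- z))"
  have H: "H z = indicator (cball 0 1) z * ((\<phi> (x \<bullet> z / norm z) - \<phi> (- (x \<bullet> z / norm z))) * (x \<bullet> z))" for z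
    by (simp add: H_def h_def algebra_simps indicator_def)
  have diff_mono: "\<phi> s - \<phi> (- s) \<le> \<phi> t - \<phi> (- t)" if "s \<le> t" for s t
    using monoD[OF \<open>mono \<phi>\<close>, of s t] monoD[OF \<open>mono \<phi>\<close>, of "-t" "-s"] that by simp
  have H_nonneg: "H z \<ge> 0" for z
  proof (cases "x \<bullet> z \<ge> 0")
    case True
    then show ?thesis
      using diff_mono[of 0 "x \<bullet> z / norm z"] by (simp add: H)
  next
    case False
    then have "x \<bullet> z / norm z \<le> 0"
      by (simp add: divide_nonpos_nonneg)
    then show ?thesis
      using False diff_mono[of "x \<bullet> z / norm z" 0] by (simp add: H mult_nonpos_nonpos)
  qed
  have H_int: "integrable lborel H"
    unfolding H_def using int int' by simp
  \<comment> \<open>The part of the unit ball where the cosine of the angle to \<open>x\<close>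
    exceeds \<open>t0\<close>, so that the hypothesis on \<open>t0\<close> makes \<open>H\<close>
    strictly positive.\<close>
  define V where "V = {z. t0 * norm z < x \<bullet> z} \<inter> ball 0 1"
  have "open V"
    unfolding V_def by (intro open_Int open_Collect_less continuous_intros open_ball)
  moreover have "(1/2) *\<^sub>R x \<in> V"
    using x t0 by (simp add: V_def dot_square_norm)
  ultimately have "\<not> negligible V"
    using open_not_negligible by blast
  have H_pos: "H z > 0" if "z \<in> V" for z
  proof -
    have z: "t0 * norm z < x \<bullet> z" "norm z < 1" "z \<noteq> 0"
      using that by (auto simp: V_def)
    then have "t0 \<le> x \<bullet> z / norm z"
      by (simp add: field_simps)
    then have "0 < \<phi> (x \<bullet> z / norm z) - \<phi> (- (x \<bullet> z / norm z))"
      using diff_mono t0(3) by (smt (verit))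
    moreover have "x \<bullet> z > 0"
      using z t0 by (smt (verit) mult_nonneg_nonneg norm_ge_zero)
    ultimately show ?thesis
      using z by (simp add: H)
  qed
  have "integral\<^sup>L lborel H \<noteq> 0"
  proof
    assume "integral\<^sup>L lborel H = 0"
    then have "AE z in lborel. H z = 0"
      using integral_nonneg_eq_0_iff_AE[OF H_int] H_nonneg by simp
    then have "AE z in lborel. z \<notin> V"
      by eventually_elim (use H_pos in force)
    then have "V \<in> null_sets lborel"
      using \<open>open V\<close> AE_iff_null_sets[of V lborel] by simp
    then show False
      using \<open>\<not> negligible V\<close> negligible_iff_null_sets null_sets_completionI by blast
  qed
  then have "integral\<^sup>L lborel H > 0"
    using H_nonneg by (simp add: order_less_le)
  moreover have "integral\<^sup>L lborel H = 2 * (\<integral>z. x \<bullet> h z \<partial>lborel)"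
    unfolding H_def using int int' refl by simp
  ultimately show ?thesis
    by simp
qed

section \<open>Linear geometry of spheres, secants and reflections\<close>

text \<open>A connected sphere with more than one point has no isolated points, so \<open>V\<close>
  contains a second point of the sphere. Disjoint neighbourhoods of the two points each meet
  \<open>Y\<close>.\<close>

lemma dense_in_sphere_two_points:
  fixes Y V :: "'a::euclidean_space set"
  assumes "2 \<le> DIM('a)" "sphere 0 1 \<subseteq> closure Y" "open V" "z \<in> V" "norm z = 1"
  obtains y y' where "y \<in> Y" "y' \<in> Y" "y \<noteq> y'" "y \<in> V" "y' \<in> V"
proof -
  have "2 *\<^sub>R z \<noteq> 0"
    using \<open>norm z = 1\<close> by auto
  then have "- z \<noteq> z"
    by (metis scaleR_2 add.right_inverse)
  then obtain w :: 'a where w: "norm w = 1" "w \<noteq> z"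
    using \<open>norm z = 1\<close> by (metis norm_minus_cancel)
  then have "\<not> (\<exists>a. sphere (0::'a) 1 = {a})"
    using \<open>norm z = 1\<close> by (auto simp: set_eq_iff) (metis)
  then have "z islimpt sphere (0::'a) 1"
    using assms by (intro connected_imp_perfect connected_sphere) auto
  then obtain z' where z': "norm z' = 1" "z' \<in> V" "z' \<noteq> z"
    using assms(3,4) unfolding islimpt_def by auto
  obtain P Q where PQ: "open P" "open Q" "z \<in> P" "z' \<in> Q" "P \<inter> Q = {}"
    using hausdorff[of z z'] z' by auto
  have meets: "\<exists>y\<in>Y. y \<in> V \<inter> W" if "open W" "u \<in> V \<inter> W" "norm u = 1" for u W
  proof -
    have "u \<in> closure Y"
      using that assms(2) by auto
    then show ?thesis
      using that \<open>open V\<close> open_Int_closure_eq_empty[of "V \<inter> W" Y] by blast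
  qed
  obtain y y' where "y \<in> Y" "y \<in> V \<inter> P" "y' \<in> Y" "y' \<in> V \<inter> Q"
    using meets[of P z] meets[of Q z'] PQ z' assms by auto
  then show thesis
    using PQ(5) that by blast
qed

text \<open>On the hyperplane orthogonal to \<open>v\<close> the sign conditions force
  \<open>x \<bullet> a\<close> to vanish throughout \<open>C\<close>. As \<open>C\<close> is open
  and meets that hyperplane, \<open>a\<close> has no component orthogonal to
  \<open>v\<close>.\<close>

lemma inner_sign_imp_parallel:
  fixes v a :: "'a::real_inner"
  assumes "open C" "p \<in> C" "p \<bullet> v = 0" "v \<noteq> 0"
    and pos: "\<And>x. x \<in> C \<Longrightarrow> 0 < x \<bullet> v \<Longrightarrow> 0 \<le> x \<bullet> a"
    and neg: "\<And>x. x \<in> C \<Longrightarrow> x \<bullet> v < 0 \<Longrightarrow> x \<bullet> a \<le> 0"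
  obtains c where "0 \<le> c" "a = c *\<^sub>R v"
proof -
  have near: "\<exists>\<epsilon>>0. q + \<epsilon> *\<^sub>R b \<in> C" if "q \<in> C" for q b
  proof -
    obtain e where e: "e > 0" "ball q e \<subseteq> C"
      using \<open>open C\<close> \<open>q \<in> C\<close> openE by blast
    define \<epsilon> where "\<epsilon> = e / (2 * (norm b + 1))"
    have b1: "norm b + 1 > 0"
      by (smt (verit) norm_ge_zero)
    have "\<epsilon> > 0"
      using e b1 by (simp add: \<epsilon>_def)
    have "\<epsilon> * norm b < e"
      using e b1 by (simp add: \<epsilon>_def field_simps) (smt (verit) mult_nonneg_nonneg norm_ge_zero)
    then have "q + \<epsilon> *\<^sub>R b \<in> ball q e"
      using \<open>\<epsilon> > 0\<close> by (simp add: dist_norm)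
    with \<open>\<epsilon> > 0\<close> e show ?thesis
      by blast
  qed
  have vv: "v \<bullet> v > 0"
    using \<open>v \<noteq> 0\<close> by simp
  \<comment> \<open>Shifting \<open>q\<close> slightly along \<open>v\<close> or \<open>- v\<close>
    reaches points where \<open>pos\<close> or \<open>neg\<close> applies. The two one-sided limits
    give the two inequalities.\<close>
  have orth: "q \<bullet> a = 0" if "q \<in> C" "q \<bullet> v = 0" for q
  proof (rule antisym)
    have "(\<lambda>s. (q + s *\<^sub>R v) \<bullet> a) \<midarrow>0\<rightarrow> (q + 0 *\<^sub>R v) \<bullet> a"
      by (intro tendsto_intros)
    then have lim: "((\<lambda>s. (q + s *\<^sub>R v) \<bullet> a) \<longlongrightarrow> q \<bullet> a) (at_right 0)"
      "((\<lambda>s. (q + s *\<^sub>R v) \<bullet> a) \<longlongrightarrow> q \<bullet> a) (at_left 0)"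
      by (auto intro: filterlim_mono at_le)
    have "((\<lambda>s. q + s *\<^sub>R v) \<longlongrightarrow> q + 0 *\<^sub>R v) (at (0::real))"
      by (intro tendsto_intros)
    then have ev: "eventually (\<lambda>s. q + s *\<^sub>R v \<in> C) (at (0::real))"
      using \<open>open C\<close> \<open>q \<in> C\<close> by (auto dest: topological_tendstoD)
    have "eventually (\<lambda>s. 0 \<le> (q + s *\<^sub>R v) \<bullet> a) (at_right 0)"
      using filter_leD[OF at_le[of "{0<..}" UNIV "0::real"] ev, simplified] eventually_at_right_less[of 0]
      by eventually_elim (rule pos, assumption, use vv that in \<open>simp add: inner_add_left\<close>)
    then show "0 \<le> q \<bullet> a"
      using tendsto_lowerbound[OF lim(1)] by simp
    have "eventually (\<lambda>s. s < (0::real)) (at_left 0)"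
      by (simp add: eventually_at_filter)
    with filter_leD[OF at_le[of "{..<0}" UNIV "0::real"] ev, simplified]
    have "eventually (\<lambda>s. (q + s *\<^sub>R v) \<bullet> a \<le> 0) (at_left 0)"
      by eventually_elim (rule neg, assumption, use vv that in \<open>simp add: inner_add_left mult_neg_pos\<close>)
    then show "q \<bullet> a \<le> 0"
      using tendsto_upperbound[OF lim(2)] by simp
  qed
  define c where "c = (a \<bullet> v) / (v \<bullet> v)"
  \<comment> \<open>The component of \<open>a\<close> orthogonal to \<open>v\<close>. Moving
    \<open>p\<close> along \<open>b\<close> stays in the hyperplane, so \<open>orth\<close> at both
    points gives \<open>b \<bullet> a = 0\<close>.\<close>
  define b where "b = a - c *\<^sub>R v"
  have bv: "b \<bullet> v = 0"
    using vv by (simp add: b_def c_def inner_diff_left)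
  obtain \<epsilon> where \<epsilon>: "\<epsilon> > 0" "p + \<epsilon> *\<^sub>R b \<in> C"
    using near[OF \<open>p \<in> C\<close>] by blast
  have "(p + \<epsilon> *\<^sub>R b) \<bullet> a = 0"
    using \<epsilon> assms(3) bv by (intro orth) (auto simp: inner_add_left)
  then have "b \<bullet> a = 0"
    using orth[OF assms(2,3)] \<epsilon>(1) by (simp add: inner_add_left)
  then have "b \<bullet> b = 0"
    using bv by (simp add: b_def inner_diff_right)
  then have a: "a = c *\<^sub>R v"
    by (simp add: b_def)
  obtain \<epsilon> where \<epsilon>: "\<epsilon> > 0" "p + \<epsilon> *\<^sub>R v \<in> C"
    using near[OF \<open>p \<in> C\<close>] by blast
  then have "0 \<le> (p + \<epsilon> *\<^sub>R v) \<bullet> a"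
    using assms(3) vv by (intro pos) (auto simp: inner_add_left)
  then have "0 \<le> \<epsilon> * (c * (v \<bullet> v))"
    using a assms(3) by (simp add: inner_add_left mult.left_commute)
  then have "0 \<le> c"
    using \<epsilon>(1) vv by (simp add: zero_le_mult_iff)
  with a show thesis
    using that by blast
qed

text \<open>A line meets a sphere in at most two points.\<close>
lemma sphere_secants_independent:
  fixes y y' z :: "'a::real_inner"
  assumes nrm: "norm y = r" "norm y' = r" "norm z = r" and ne: "y \<noteq> y'" "z \<noteq> y" "z \<noteq> y'"
    and eq: "\<alpha> *\<^sub>R (z - y) + \<beta> *\<^sub>R (y - y') = 0"
  shows "\<alpha> = 0" "\<beta> = 0"
proof -
  have "\<alpha> = 0"
  proof (rule ccontr)
    assume "\<alpha> \<noteq> 0"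
    define s where "s = - \<beta> / \<alpha>"
    define b where "b = y - y'"
    have "\<alpha> *\<^sub>R (z - y) = \<alpha> *\<^sub>R (s *\<^sub>R b)"
      using eq \<open>\<alpha> \<noteq> 0\<close> by (simp add: s_def b_def eq_neg_iff_add_eq_0)
    then have z: "z = y + s *\<^sub>R b"
      using \<open>\<alpha> \<noteq> 0\<close> scaleR_left_imp_eq[of \<alpha> "z - y" "s *\<^sub>R b"] by (simp add: algebra_simps)
    have y': "y' = y - b"
      by (simp add: b_def)
    have "z \<bullet> z = y \<bullet> y" "y' \<bullet> y' = y \<bullet> y"
      using nrm by (simp_all add: dot_square_norm)
    then have "2 * s * (y \<bullet> b) + s * s * (b \<bullet> b) = 0" "b \<bullet> b = 2 * (y \<bullet> b)"
      unfolding z y' by (simp_all add: inner_add inner_diff inner_commute algebra_simps)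
    \<comment> \<open>The roots \<open>0\<close> and \<open>-1\<close> correspond to the endpoints
      \<open>y\<close> and \<open>y'\<close> of the secant.\<close>
    then have "s * (s + 1) * (b \<bullet> b) = 0"
      by (simp add: algebra_simps)
    moreover have "b \<bullet> b \<noteq> 0"
      using ne by (simp add: b_def)
    ultimately have "s = 0 \<or> s = - 1"
      by (auto simp: eq_neg_iff_add_eq_0)
    then show False
      using ne z y' by auto
  qed
  then show "\<alpha> = 0" "\<beta> = 0"
    using eq ne by auto
qed

text \<open>Comparing the two expressions for \<open>k z - k y'\<close> in terms of independent secants.\<close>
lemma affine_on_sphere_third_point:
  fixes y y' z :: "'a::real_inner" and k :: "'a \<Rightarrow> 'a"
  assumes "norm y = r" "norm y' = r" "norm z = r" "y \<noteq> y'"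
    and "k y - k y' = c *\<^sub>R (y - y')"
    and "k z - k y = c1 *\<^sub>R (z - y)"
    and "k z - k y' = c2 *\<^sub>R (z - y')"
  shows "k z - k y = c *\<^sub>R (z - y)"
proof (cases "z = y \<or> z = y'")
  case True
  then show ?thesis
    using assms(5) by (metis diff_self minus_diff_eq scaleR_minus_right scaleR_zero_right)
next
  case False
  have "c1 *\<^sub>R (z - y) + c *\<^sub>R (y - y') = k z - k y'"
    by (simp flip: assms(5,6))
  also have "\<dots> = c2 *\<^sub>R ((z - y) + (y - y'))"
    by (simp add: assms(7))
  finally have "c1 *\<^sub>R (z - y) + c *\<^sub>R (y - y') = c2 *\<^sub>R ((z - y) + (y - y'))" .
  then have "(c1 - c2) *\<^sub>R (z - y) + (c - c2) *\<^sub>R (y - y') = 0"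
    by (simp add: algebra_simps)
  then have "c1 - c2 = 0" "c - c2 = 0"
    using sphere_secants_independent[OF assms(1-4)] False by blast+
  then show ?thesis
    using assms(6) by simp
qed

text \<open>Tilting the axis from \<open>p\<close> towards \<open>z\<close> by
  \<open>\<delta>\<close> makes the half-turn about it raise the height \<open>p \<bullet> z\<close>
  by a fixed amount. This uniform gain is what rules out a supremum of the heights of exceptional
  points later on.\<close>

lemma reflection_towards_pole:
  fixes p z :: "'a::euclidean_space"
  assumes "2 \<le> DIM('a)" "norm p = 1" "norm z = 1" "0 < \<delta>" "\<delta> < 1" "p \<bullet> z \<le> 1 - 4 * \<delta>\<^sup>2"
  obtains x where "x \<noteq> 0" "norm (x - p) = \<delta>"
    and "p \<bullet> z + \<delta>\<^sup>2 \<le> p \<bullet> ((2 * (x \<bullet> z) / (x \<bullet> x)) *\<^sub>R x - z)"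
proof -
  define t where "t = p \<bullet> z"
  define s where "s = sqrt (1 - t\<^sup>2)"
  have pp: "p \<bullet> p = 1" and zz: "z \<bullet> z = 1"
    using assms by (simp_all add: dot_square_norm)
  have abs_t: "\<bar>t\<bar> \<le> 1"
    using Cauchy_Schwarz_ineq2[of p z] assms by (simp add: t_def)
  then have s2: "s\<^sup>2 = 1 - t\<^sup>2" and "0 \<le> s"
    by (simp_all add: s_def abs_square_le_1)
  have proj: "(z - t *\<^sub>R p) \<bullet> (z - t *\<^sub>R p) = s\<^sup>2" "z \<bullet> (z - t *\<^sub>R p) = s\<^sup>2"
    using s2 by (simp_all add: inner_diff inner_commute[of z p] pp zz power2_eq_square flip: t_def)
  \<comment> \<open>The unit vector orthogonal to \<open>p\<close> that points towards
    \<open>z\<close>. If \<open>s = 0\<close> then \<open>z\<close> is a multiple of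
    \<open>p\<close>, and any unit vector orthogonal to \<open>p\<close> serves.\<close>
  obtain u where u: "norm u = 1" "p \<bullet> u = 0" "z \<bullet> u = s"
  proof (cases "s = 0")
    case True
    obtain w :: 'a where w: "w \<noteq> 0" "orthogonal p w"
      using assms(1) orthogonal_to_vector_exists by blast
    have "z = t *\<^sub>R p"
      using proj(1) True by simp
    with w True show thesis
      by (intro that[of "w /\<^sub>R norm w"]) (auto simp: orthogonal_def)
  next
    case False
    define u where "u = (z - t *\<^sub>R p) /\<^sub>R s"
    have "u \<bullet> u = 1"
      using False by (simp add: u_def proj(1) power2_eq_square) (simp add: field_simps)
    moreover have "p \<bullet> u = 0"
      by (simp add: u_def inner_diff_right pp t_def)
    moreover have "z \<bullet> u = s"
      using False by (simp add: u_def proj(2) power2_eq_square)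
    ultimately show thesis
      by (intro that) (auto simp: norm_eq_1)
  qed
  \<comment> \<open>The height grows by
    \<open>2 * \<delta> * (s - \<delta> * t) / (1 + \<delta>\<^sup>2)\<close>, so this bound yields
    the gain \<open>\<delta>\<^sup>2\<close>. For \<open>t > 0\<close> it rests on
    \<open>2 * \<delta> \<le> s\<close>, which is where the distance of \<open>z\<close> from the
    pole enters.\<close>
  have gain: "\<delta> \<le> s - \<delta> * t"
  proof (cases "t \<le> 0")
    case True
    have "1 \<le> (s - t)\<^sup>2"
      using s2 mult_nonneg_nonpos[OF \<open>0 \<le> s\<close> True] by (simp add: power2_diff)
    then have "1 \<le> s - t"
      using True \<open>0 \<le> s\<close> power2_le_imp_le[of 1 "s - t"] by simp
    then have "\<delta> * 1 \<le> \<delta> * (s - t)"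
      using assms(4) by (intro mult_left_mono) auto
    also have "\<dots> \<le> s - \<delta> * t"
      using assms(4,5) \<open>0 \<le> s\<close> mult_right_mono[of \<delta> 1 s] by (simp add: algebra_simps)
    finally show ?thesis by simp
  next
    case False
    have "(1 - t) * 1 \<le> (1 - t) * (1 + t)"
      using False abs_t by (intro mult_left_mono) auto
    also have "\<dots> = s\<^sup>2"
      unfolding s2 by (simp add: power2_eq_square algebra_simps)
    finally have "(2 * \<delta>)\<^sup>2 \<le> s\<^sup>2"
      using assms(6) by (simp add: t_def)
    then have "2 * \<delta> \<le> s"
      using \<open>0 \<le> s\<close> power2_le_imp_le by blast
    moreover have "\<delta> * t \<le> \<delta>"
      using abs_t assms(4) by (simp add: mult_left_le)
    ultimately show ?thesis by linarith
  qed
  define x where "x = p + \<delta> *\<^sub>R u"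
  have uu: "u \<bullet> u = 1"
    using u by (simp add: dot_square_norm)
  have xx: "x \<bullet> x = 1 + \<delta>\<^sup>2" "x \<bullet> z = t + \<delta> * s" "p \<bullet> x = 1"
    using u by (simp_all add: x_def inner_add inner_commute pp uu power2_eq_square t_def)
  have pos: "1 + \<delta>\<^sup>2 > 0"
    by (smt (verit) zero_le_power2)
  have "\<delta>\<^sup>2 * (1 + \<delta>\<^sup>2) \<le> \<delta>\<^sup>2 * 2"
    using assms(4,5) by (intro mult_left_mono) (auto simp: power_le_one)
  also have "\<dots> \<le> 2 * \<delta> * (s - \<delta> * t)"
    using mult_left_mono[OF gain, of "2 * \<delta>"] assms(4) by (simp add: power2_eq_square)
  finally have "\<delta>\<^sup>2 \<le> 2 * \<delta> * (s - \<delta> * t) / (1 + \<delta>\<^sup>2)"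
    using pos by (simp add: pos_le_divide_eq)
  also have "\<dots> = 2 * (t + \<delta> * s) / (1 + \<delta>\<^sup>2) - 2 * t"
    using pos by (simp add: field_simps power2_eq_square)
  finally have "t + \<delta>\<^sup>2 \<le> 2 * (t + \<delta> * s) / (1 + \<delta>\<^sup>2) - t"
    by simp
  then have "p \<bullet> z + \<delta>\<^sup>2 \<le> p \<bullet> ((2 * (x \<bullet> z) / (x \<bullet> x)) *\<^sub>R x - z)"
    by (simp add: inner_diff_right xx flip: t_def)
  moreover have "x \<noteq> 0"
    using xx(3) by auto
  moreover have "norm (x - p) = \<delta>"
    using u assms(4) by (simp add: x_def)
  ultimately show thesis
    using that by blast
qed

text \<open>Comparing the norms at \<open>z\<close> and \<open>- z\<close> shows that the range of
  \<open>C\<close> is orthogonal to \<open>e\<close>. That range is the whole space, so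
  \<open>e\<close> is orthogonal to itself.\<close>

lemma affine_sphere_map_orthogonal:
  fixes C :: "'a::euclidean_space \<Rightarrow> 'a"
  assumes "linear C" "inj C" and sph: "\<And>z. norm z = 1 \<Longrightarrow> norm (C z + e) = 1"
  shows "e = 0" "orthogonal_transformation C"
proof -
  have "C z \<bullet> e = 0" if "norm z = 1" for z
  proof -
    have "(C z + e) \<bullet> (C z + e) = 1" "(C (- z) + e) \<bullet> (C (- z) + e) = 1"
      using sph[of z] sph[of "- z"] that by (auto simp: dot_square_norm)
    then show ?thesis
      by (simp add: linear_neg[OF \<open>linear C\<close>] inner_add inner_diff inner_commute)
  qed
  then have orth: "C z \<bullet> e = 0" if "z \<noteq> 0" for z
  proof -
    have "C (z /\<^sub>R norm z) \<bullet> e = 0"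
      using \<open>\<And>z. norm z = 1 \<Longrightarrow> C z \<bullet> e = 0\<close> that by simp
    then show ?thesis
      using that by (simp add: linear_scale[OF \<open>linear C\<close>])
  qed
  obtain z where z: "C z = e"
    using linear_injective_imp_surjective[OF assms(1,2)] by (metis surjD)
  show "e = 0"
    using orth[of z] z linear_0[OF \<open>linear C\<close>] by (cases "z = 0") auto
  have "norm (C z) = norm z" for z
  proof (cases "z = 0")
    case False
    then have "norm (C (z /\<^sub>R norm z)) = 1"
      using sph[of "z /\<^sub>R norm z"] \<open>e = 0\<close> by simp
    then show ?thesis
      using False by (simp add: linear_scale[OF \<open>linear C\<close>] field_simps)
  qed (simp add: linear_0[OF \<open>linear C\<close>])
  then show "orthogonal_transformation C"
    using \<open>linear C\<close> by (simp add: orthogonal_transformation)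
qed

section \<open>Weakly monotone pairs and their profiles\<close>

text \<open>These are the properties of an accumulation point that the rigidity argument uses. Weak
  inequalities survive pointwise limits, so the sequences themselves no longer appear.\<close>

locale weakly_monotone_pair =
  fixes X Y :: "'a::euclidean_space set" and f g :: "'a \<Rightarrow> 'a"
  assumes dim: "2 \<le> DIM('a)"
    and X_sphere: "X \<subseteq> sphere 0 1" and Y_sphere: "Y \<subseteq> sphere 0 1"
    and f_sphere: "f \<in> X \<rightarrow> sphere 0 1" and g_sphere: "g \<in> Y \<rightarrow> sphere 0 1"
    and weak_mono: "\<And>x y y'. \<lbrakk>x \<in> X; y \<in> Y; y' \<in> Y; x \<bullet> y < x \<bullet> y'\<rbrakk> \<Longrightarrow> f x \<bullet> g y \<le> f x \<bullet> g y'"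
    and Y_dense: "sphere 0 1 \<subseteq> closure Y"
    and gY_dense: "sphere 0 1 \<subseteq> closure (g ` Y)"
begin

lemma norm_eq_1_X: "x \<in> X \<Longrightarrow> norm x = 1"
  and norm_eq_1_Y: "y \<in> Y \<Longrightarrow> norm y = 1"
  and norm_f: "x \<in> X \<Longrightarrow> norm (f x) = 1"
  and norm_g: "y \<in> Y \<Longrightarrow> norm (g y) = 1"
  using X_sphere Y_sphere f_sphere g_sphere by auto

lemma abs_fg_le: "\<lbrakk>x \<in> X; y \<in> Y\<rbrakk> \<Longrightarrow> \<bar>f x \<bullet> g y\<bar> \<le> 1"
  using Cauchy_Schwarz_ineq2[of "f x" "g y"] by (simp add: norm_f norm_g)

text \<open>Up to its jumps, \<open>f x \<bullet> g y\<close> is the function \<open>profile x\<close> of \<open>x \<bullet> y\<close>. The value \<open>-1\<close> is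
  inserted because no \<open>y\<close> satisfies \<open>x \<bullet> y < t\<close> when \<open>t \<le> -1\<close>.\<close>
definition profile :: "'a \<Rightarrow> real \<Rightarrow> real" where
  "profile x t = Sup (insert (-1) {f x \<bullet> g y |y. y \<in> Y \<and> x \<bullet> y < t})"

lemma profile_bdd_above:
  "x \<in> X \<Longrightarrow> bdd_above (insert (-1) {f x \<bullet> g y |y. y \<in> Y \<and> x \<bullet> y < t})"
  by (rule bdd_aboveI[of _ 1]) (use abs_fg_le in \<open>force simp: abs_le_iff\<close>)

lemma profile_upper: "\<lbrakk>x \<in> X; y \<in> Y; x \<bullet> y < t\<rbrakk> \<Longrightarrow> f x \<bullet> g y \<le> profile x t"
  unfolding profile_def by (intro cSup_upper profile_bdd_above) auto

lemma profile_lower: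
  assumes "x \<in> X" "y \<in> Y" "t < x \<bullet> y"
  shows "profile x t \<le> f x \<bullet> g y"
  unfolding profile_def
proof (rule cSup_least)
  fix r assume "r \<in> insert (-1) {f x \<bullet> g y |y. y \<in> Y \<and> x \<bullet> y < t}"
  then show "r \<le> f x \<bullet> g y"
    using weak_mono assms abs_fg_le[of x y] by (fastforce simp: abs_le_iff)
qed simp

lemma abs_profile_le: "x \<in> X \<Longrightarrow> \<bar>profile x t\<bar> \<le> 1"
  unfolding abs_le_iff
proof
  assume "x \<in> X"
  have "profile x t \<le> 1"
    unfolding profile_def by (rule cSup_least) (use abs_fg_le[OF \<open>x \<in> X\<close>] in \<open>force simp: abs_le_iff\<close>)+
  then show "profile x t \<le> 1" .
  have "- 1 \<le> profile x t"
    unfolding profile_def by (intro cSup_upper profile_bdd_above \<open>x \<in> X\<close>) auto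
  then show "- profile x t \<le> 1" by simp
qed

lemma mono_profile: "x \<in> X \<Longrightarrow> mono (profile x)"
  unfolding profile_def by (intro monoI cSup_subset_mono profile_bdd_above) auto

text \<open>The point \<open>w\<close> is a cluster value of \<open>g\<close> at \<open>z\<close>.\<close>
lemma profile_cluster_value:
  assumes "norm z = 1"
  obtains w where "\<And>x. \<lbrakk>x \<in> X; isCont (profile x) (x \<bullet> z)\<rbrakk> \<Longrightarrow> f x \<bullet> w = profile x (x \<bullet> z)"
proof -
  have "z \<in> closure Y"
    using Y_dense assms by auto
  then obtain \<eta> where \<eta>: "\<And>n. \<eta> n \<in> Y" "\<eta> \<longlonglongrightarrow> z"
    unfolding closure_sequential by blast
  have "\<forall>n. (g \<circ> \<eta>) n \<in> sphere 0 1"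
    using \<eta>(1) norm_g by simp
  then obtain w r where r: "strict_mono r" "((g \<circ> \<eta>) \<circ> r) \<longlonglongrightarrow> w"
    by (metis seq_compactE[OF compact_imp_seq_compact[OF compact_sphere]])
  have lim_\<eta>: "(\<lambda>n. \<eta> (r n)) \<longlonglongrightarrow> z"
    using LIMSEQ_subseq_LIMSEQ[OF \<eta>(2) r(1)] by (simp add: o_def)
  show thesis
  proof
    fix x assume x: "x \<in> X" and cont: "isCont (profile x) (x \<bullet> z)"
    have lim_x: "(\<lambda>n. x \<bullet> \<eta> (r n)) \<longlonglongrightarrow> x \<bullet> z" and lim_f: "(\<lambda>n. f x \<bullet> g (\<eta> (r n))) \<longlonglongrightarrow> f x \<bullet> w"
      using lim_\<eta> r(2) by (auto simp: o_def intro: tendsto_intros)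
    have upper: "f x \<bullet> w \<le> profile x t" if "x \<bullet> z < t" for t
      using order_tendstoD(2)[OF lim_x that] x \<eta>(1)
      by (intro tendsto_upperbound[OF lim_f]) (auto elim!: eventually_mono intro: profile_upper)
    have lower: "profile x t \<le> f x \<bullet> w" if "t < x \<bullet> z" for t
      using order_tendstoD(1)[OF lim_x that] x \<eta>(1)
      by (intro tendsto_lowerbound[OF lim_f]) (auto elim!: eventually_mono intro: profile_lower)
    \<comment> \<open>Continuity lets \<open>t\<close> tend to \<open>x \<bullet> z\<close> from the
      right in \<open>upper\<close> and from the left in \<open>lower\<close>.\<close>
    have "(profile x \<longlongrightarrow> profile x (x \<bullet> z)) (at_right (x \<bullet> z))"
      "(profile x \<longlongrightarrow> profile x (x \<bullet> z)) (at_left (x \<bullet> z))"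
      using cont unfolding isCont_def by (auto intro: filterlim_mono at_le)
    then show "f x \<bullet> w = profile x (x \<bullet> z)"
      using upper lower
      by (intro antisym tendsto_lowerbound[of "profile x" _ "at_right (x \<bullet> z)"]
          tendsto_upperbound[of "profile x" _ "at_left (x \<bullet> z)"])
        (auto simp: eventually_at_filter)
  qed
qed

text \<open>Otherwise the monotone profile would be constant on the open interval from
  \<open>-1\<close> to \<open>1\<close>, and \<open>f x \<bullet> g y\<close> would take finitely
  many values. Density carries this over to \<open>f x \<bullet> w\<close> on the whole sphere,
  where connectedness makes it constant, although \<open>f x\<close> and \<open>- f x\<close> give
  different values.\<close>

lemma profile_not_even:
  assumes x: "x \<in> X"
  obtains t where "0 < t" "t < 1" "profile x (- t) < profile x t"
proof -
  have "\<exists>t. 0 < t \<and> t < 1 \<and> profile x (- t) < profile x t"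
  proof (rule ccontr)
    assume "\<not> ?thesis"
    then have *: "profile x t \<le> profile x (- t)" if "0 < t" "t < 1" for t
      using that by (meson not_le)
    have const: "profile x t = profile x 0" if "\<bar>t\<bar> < 1" for t
    proof (cases "t = 0")
      case False
      have "profile x (- \<bar>t\<bar>) \<le> profile x 0" "profile x 0 \<le> profile x \<bar>t\<bar>"
        "profile x (- \<bar>t\<bar>) \<le> profile x t" "profile x t \<le> profile x \<bar>t\<bar>"
        by (intro monoD[OF mono_profile[OF x]]; simp)+
      then show ?thesis
        using *[of "\<bar>t\<bar>"] that False by simp
    qed simp
    \<comment> \<open>The last two values cover the points with
      \<open>\<bar>x \<bullet> y\<bar> = 1\<close>, which are \<open>x\<close> and
      \<open>- x\<close>. If one of these is not in \<open>Y\<close>, its value merely enlarges the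
      finite set.\<close>
    define F where "F = {profile x 0, f x \<bullet> g x, f x \<bullet> g (- x)}"
    have "f x \<bullet> g y \<in> F" if "y \<in> Y" for y
    proof (cases "\<bar>x \<bullet> y\<bar> < 1")
      case True
      \<comment> \<open>The midpoints between \<open>x \<bullet> y\<close> and \<open>1\<close> or
        \<open>-1\<close> enclose \<open>x \<bullet> y\<close> and stay where the profile is
        constant.\<close>
      then have "\<bar>(x \<bullet> y + 1) / 2\<bar> < 1" "\<bar>(x \<bullet> y - 1) / 2\<bar> < 1" "x \<bullet> y < (x \<bullet> y + 1) / 2" "(x \<bullet> y - 1) / 2 < x \<bullet> y"
        by (auto simp: abs_less_iff)
      then have "f x \<bullet> g y = profile x 0"
        using profile_upper[OF x that] profile_lower[OF x that] const by (metis antisym)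
      then show ?thesis by (simp add: F_def)
    next
      case False
      then have "\<bar>x \<bullet> y\<bar> = norm x * norm y"
        using Cauchy_Schwarz_ineq2[of x y] x that by (simp add: norm_eq_1_X norm_eq_1_Y)
      then have "norm x *\<^sub>R y = norm y *\<^sub>R x \<or> norm x *\<^sub>R y = - norm y *\<^sub>R x"
        using norm_cauchy_schwarz_abs_eq by blast
      then have "y = x \<or> y = - x"
        using x that by (simp add: norm_eq_1_X norm_eq_1_Y)
      then show ?thesis by (auto simp: F_def)
    qed
    then have "g ` Y \<subseteq> (\<lambda>w. f x \<bullet> w) -` F"
      by auto
    moreover have "closed ((\<lambda>w. f x \<bullet> w) -` F)"
      by (intro continuous_closed_vimage finite_imp_closed) (auto simp: F_def intro: continuous_intros)
    ultimately have "sphere 0 1 \<subseteq> (\<lambda>w. f x \<bullet> w) -` F"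
      using gY_dense closure_minimal by blast
    then have sub: "(\<lambda>w. f x \<bullet> w) ` sphere 0 1 \<subseteq> F"
      by auto
    have "connected ((\<lambda>w. f x \<bullet> w) ` sphere (0::'a) 1)"
      using dim by (intro connected_continuous_image connected_sphere continuous_intros)
    moreover have "finite ((\<lambda>w. f x \<bullet> w) ` sphere (0::'a) 1)"
      using sub by (rule finite_subset) (simp add: F_def)
    ultimately obtain c where c: "(\<lambda>w. f x \<bullet> w) ` sphere (0::'a) 1 \<subseteq> {c}"
      using connected_finite_iff_sing by (metis empty_subsetI subset_refl)
    have "f x \<bullet> w = c" if "norm w = 1" for w
      using c that by (simp add: image_subset_iff)
    from this[of "f x"] this[of "- f x"] have "f x \<bullet> f x = f x \<bullet> (- f x)"
      using norm_f[OF x] by (simp del: inner_minus_right)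
    then show False
      using norm_f[OF x] by (simp add: dot_square_norm)
  qed
  then show thesis
    using that by blast
qed

section \<open>Moments and linearity of \<open>f\<close> up to positive factors\<close>

text \<open>For almost every \<open>z\<close> in the ball, one vector \<open>w\<close> gives the
  coefficient as \<open>f x \<bullet> w\<close> for all \<open>x\<close> in a given finite subset of
  \<open>X\<close>. In this sense the moment is linear in \<open>f x\<close>.\<close>

definition moment :: "'a \<Rightarrow> 'a \<Rightarrow> 'a" where
  "moment x z = (indicator (cball 0 1) z * profile x (x \<bullet> z / norm z)) *\<^sub>R z"

definition weight :: "'a \<Rightarrow> real" where
  "weight x = (\<integral>z. x \<bullet> moment x z \<partial>lborel)"

lemma integrable_moment: "x \<in> X \<Longrightarrow> integrable lborel (moment x)"
  and integral_moment: "x \<in> X \<Longrightarrow> integral\<^sup>L lborel (moment x) = weight x *\<^sub>R x"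
  unfolding moment_def weight_def
  by (intro zonal_integral_parallel norm_eq_1_X borel_measurable_mono mono_profile abs_profile_le; assumption)+

lemma weight_pos:
  assumes "x \<in> X"
  shows "0 < weight x"
proof -
  obtain t where "0 < t" "t < 1" "profile x (- t) < profile x t"
    using profile_not_even[OF assms] .
  then show ?thesis
    unfolding weight_def moment_def
    using assms by (intro zonal_integral_pos norm_eq_1_X mono_profile abs_profile_le)
qed

text \<open>A monotone function has countably many discontinuities, and each of them excludes only
  the vectors \<open>z\<close> on one negligible circular cone.\<close>

lemma AE_isCont_profile:
  assumes x: "x \<in> X"
  shows "AE z in lborel. isCont (profile x) (x \<bullet> z / norm z)"
proof -
  define D where "D = {t. \<not> isCont (profile x) t}"
  have "countable D"
    unfolding D_def by (rule mono_ctble_discont[OF mono_profile[OF x]])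
  have "negligible (insert 0 (\<Union>t\<in>D. {z. x \<bullet> z = t * norm z}))"
    unfolding negligible_insert
    using \<open>countable D\<close> negligible_circular_cone[OF norm_eq_1_X[OF x] dim]
    by (intro negligible_countable_Union) auto
  then have "AE z in lebesgue. z \<notin> insert 0 (\<Union>t\<in>D. {z. x \<bullet> z = t * norm z})"
    unfolding negligible_iff_null_sets by (rule AE_not_in)
  then have "AE z in lborel. z \<notin> insert 0 (\<Union>t\<in>D. {z. x \<bullet> z = t * norm z})"
    by (simp only: AE_completion_iff)
  then show ?thesis
    by eventually_elim (auto simp: D_def)
qed

text \<open>A dependency between the \<open>f x\<close> holds between the profiles at almost every point, by
  \<open>profile_cluster_value\<close>; integrating it turns it into a dependency between the \<open>x\<close>.\<close>
lemma dependency_transfer: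
  assumes "finite I" "I \<subseteq> X" and dep: "(\<Sum>x\<in>I. c x *\<^sub>R f x) = 0"
  shows "(\<Sum>x\<in>I. (c x * weight x) *\<^sub>R x) = 0"
proof -
  have "AE z in lborel. \<forall>x\<in>I. isCont (profile x) (x \<bullet> z / norm z)"
    using assms(1,2) AE_isCont_profile by (intro AE_finite_allI) auto
  then have "AE z in lborel. (\<Sum>x\<in>I. c x *\<^sub>R moment x z) = 0"
  proof eventually_elim
    fix z :: 'a assume cont: "\<forall>x\<in>I. isCont (profile x) (x \<bullet> z / norm z)"
    show "(\<Sum>x\<in>I. c x *\<^sub>R moment x z) = 0"
    proof (cases "z = 0")
      case False
      then obtain w where w: "\<And>x. \<lbrakk>x \<in> X; isCont (profile x) (x \<bullet> (z /\<^sub>R norm z))\<rbrakk>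
          \<Longrightarrow> f x \<bullet> w = profile x (x \<bullet> (z /\<^sub>R norm z))"
        using profile_cluster_value[of "z /\<^sub>R norm z"] by (metis norm_sgn sgn_div_norm)
      have "moment x z = ((f x \<bullet> w) * indicator (cball 0 1) z) *\<^sub>R z" if "x \<in> I" for x
        using w[of x] that cont assms(2) by (auto simp: moment_def divide_inverse mult.commute)
      then have "(\<Sum>x\<in>I. c x *\<^sub>R moment x z) = (((\<Sum>x\<in>I. c x *\<^sub>R f x) \<bullet> w) * indicator (cball 0 1) z) *\<^sub>R z"
        by (simp add: inner_sum_left sum_distrib_right scaleR_sum_left mult.assoc)
      then show ?thesis
        by (simp add: dep)
    qed (simp add: moment_def)
  qed
  then have "(\<integral>z. (\<Sum>x\<in>I. c x *\<^sub>R moment x z) \<partial>lborel) = 0"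
    by (rule integral_eq_zero_AE)
  moreover have "(\<integral>z. (\<Sum>x\<in>I. c x *\<^sub>R moment x z) \<partial>lborel) = (\<Sum>x\<in>I. (c x * weight x) *\<^sub>R x)"
    using assms(2) integrable_moment
    by (subst Bochner_Integration.integral_sum) (auto intro!: sum.cong simp: integral_moment subset_iff)
  ultimately show ?thesis by simp
qed

text \<open>\<open>B\<close> is prescribed on a basis taken from \<open>X\<close>. A kernel vector
  of \<open>B\<close> is a dependency between values of \<open>f\<close>, which transfers to the
  vector being zero. Then \<open>B\<close> is onto, and transferring the expansion of
  \<open>f x\<close> in the values of \<open>f\<close> on the basis identifies the preimage of
  \<open>f x\<close> as \<open>weight x *\<^sub>R x\<close>.\<close>

lemma f_linear_up_to_weight:
  assumes "span X = UNIV"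
  obtains B where "linear B" "inj B" "\<And>x. x \<in> X \<Longrightarrow> f x = weight x *\<^sub>R B x"
proof -
  obtain b where b: "b \<subseteq> X" "independent b" "X \<subseteq> span b"
    by (rule maximal_independent_subset)
  have span_b: "span b = UNIV"
    using assms span_mono[OF b(3)] by (simp add: span_span top.extremum_unique)
  have "finite b"
    using b(2) by (rule independent_imp_finite)
  obtain B where B: "linear B" "\<And>x. x \<in> b \<Longrightarrow> B x = f x /\<^sub>R weight x"
    using linear_independent_extend[OF b(2), of "\<lambda>x. f x /\<^sub>R weight x"] by blast
  have rep: "\<exists>a. v = (\<Sum>x\<in>b. a x *\<^sub>R x)" for v
    using span_b span_finite[OF \<open>finite b\<close>] by (metis (no_types, lifting) UNIV_I imageE)
  have B_sum: "B (\<Sum>x\<in>b. a x *\<^sub>R x) = (\<Sum>x\<in>b. (a x / weight x) *\<^sub>R f x)" for a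
    by (simp add: linear_sum[OF B(1)] linear_scale[OF B(1)] B(2) divide_inverse)
  have wnz: "weight x \<noteq> 0" if "x \<in> X" for x
    using weight_pos[OF that] by simp
  have "inj B"
    unfolding linear_injective_0[OF B(1)]
  proof (intro allI impI)
    fix v assume "B v = 0"
    obtain a where a: "v = (\<Sum>x\<in>b. a x *\<^sub>R x)"
      using rep by blast
    have "(\<Sum>x\<in>b. (a x / weight x) *\<^sub>R f x) = 0"
      using \<open>B v = 0\<close> by (simp add: a B_sum)
    then have "(\<Sum>x\<in>b. (a x / weight x * weight x) *\<^sub>R x) = 0"
      by (rule dependency_transfer[OF \<open>finite b\<close> b(1)])
    moreover have "(\<Sum>x\<in>b. (a x / weight x * weight x) *\<^sub>R x) = v"
      unfolding a using b(1) wnz by (intro sum.cong) auto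
    ultimately show "v = 0" by simp
  qed
  have "f x = weight x *\<^sub>R B x" if "x \<in> X" for x
  proof (cases "x \<in> b")
    case True
    then show ?thesis
      using B(2) wnz[OF that] by simp
  next
    case False
    obtain u where u: "B u = f x"
      using linear_injective_imp_surjective[OF B(1) \<open>inj B\<close>] by (metis surjD)
    obtain a where a: "u = (\<Sum>x\<in>b. a x *\<^sub>R x)"
      using rep by blast
    \<comment> \<open>Coefficients of the dependency that subtracts from \<open>f x\<close> its
      expansion in the values of \<open>f\<close> on \<open>b\<close>.\<close>
    define c where "c = (\<lambda>y. if y = x then 1 else - (a y / weight y))"
    have sum_c: "(\<Sum>y\<in>insert x b. h y (c y)) = h x 1 + (\<Sum>y\<in>b. h y (- (a y / weight y)))"
      for h :: "'a \<Rightarrow> real \<Rightarrow> 'a"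
      using False \<open>finite b\<close> by (auto simp: c_def intro!: sum.cong)
    have "(\<Sum>y\<in>insert x b. c y *\<^sub>R f y) = 0"
      using u by (simp add: sum_c[of "\<lambda>y r. r *\<^sub>R f y"] a B_sum sum_negf)
    then have "(\<Sum>y\<in>insert x b. (c y * weight y) *\<^sub>R y) = 0"
      using \<open>finite b\<close> b(1) that by (intro dependency_transfer) auto
    then have "weight x *\<^sub>R x = (\<Sum>y\<in>b. (a y / weight y * weight y) *\<^sub>R y)"
      by (simp add: sum_c[of "\<lambda>y r. (r * weight y) *\<^sub>R y"] sum_negf)
    also have "\<dots> = u"
      unfolding a using b(1) wnz by (intro sum.cong) auto
    finally show ?thesis
      using u by (simp flip: linear_scale[OF B(1)])
  qed
  with B(1) \<open>inj B\<close> show thesis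
    using that by blast
qed

section \<open>Affinity of the adjoint image of \<open>g\<close>\<close>

text \<open>On \<open>X\<close> the positive weight cancels from the monotonicity of
  \<open>f\<close> and \<open>g\<close>. A violation elsewhere consists of two strict inequalities,
  so it would persist on a neighbourhood that contains a point of \<open>X\<close>.\<close>

lemma inner_adjoint_weak_mono:
  assumes B: "linear B" "\<And>x. x \<in> X \<Longrightarrow> f x = weight x *\<^sub>R B x"
    and U: "U \<subseteq> closure X"
    and x: "x /\<^sub>R norm x \<in> U" "x \<noteq> 0" and y: "y \<in> Y" "y' \<in> Y" "x \<bullet> y < x \<bullet> y'"
  shows "x \<bullet> adjoint B (g y) \<le> x \<bullet> adjoint B (g y')"
proof (rule ccontr)
  assume "\<not> ?thesis"
  then have gt: "x \<bullet> adjoint B (g y') < x \<bullet> adjoint B (g y)"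
    by simp
  define W where "W = {x. x \<bullet> y < x \<bullet> y'} \<inter> {x. x \<bullet> adjoint B (g y') < x \<bullet> adjoint B (g y)}"
  have "open W"
    unfolding W_def by (intro open_Int open_Collect_less continuous_intros)
  moreover have "x /\<^sub>R norm x \<in> W"
    using x(2) y(3) gt by (simp add: W_def mult_strict_left_mono)
  moreover have "x /\<^sub>R norm x \<in> closure X"
    using U x(1) by blast
  ultimately obtain a where a: "a \<in> X" "a \<in> W"
    using open_Int_closure_eq_empty by blast
  then have "f a \<bullet> g y \<le> f a \<bullet> g y'"
    using weak_mono y by (simp add: W_def)
  then have "a \<bullet> adjoint B (g y) \<le> a \<bullet> adjoint B (g y')"
    using weight_pos[OF a(1)] by (simp add: B(2)[OF a(1)] adjoint_works[OF B(1)])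
  then show False
    using a(2) by (simp add: W_def)
qed

text \<open>Differences of \<open>k\<close> are parallel to secants orthogonal to some point of
  \<open>C\<close>, and triangles equate the factors. This settles the points near \<open>p\<close>.
  An exceptional point of nearly maximal height is then reflected to a higher place, where
  \<open>k\<close> is already known.\<close>

lemma affine_if_inner_weak_mono:
  assumes "open C" "p \<in> C" "norm p = 1"
    and mono_k: "\<And>x y y'. \<lbrakk>x \<in> C; y \<in> Y; y' \<in> Y; x \<bullet> y < x \<bullet> y'\<rbrakk> \<Longrightarrow> x \<bullet> k y \<le> x \<bullet> k y'"
  obtains c d where "0 \<le> c" "\<And>y. y \<in> Y \<Longrightarrow> k y = c *\<^sub>R y + d"
proof -
  have secant: "\<exists>c\<ge>0. k y - k y' = c *\<^sub>R (y - y')"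
    if "q \<in> C" "q \<bullet> (y - y') = 0" "y \<in> Y" "y' \<in> Y" for q y y'
  proof (cases "y = y'")
    case False
    show ?thesis
    proof (rule inner_sign_imp_parallel[OF \<open>open C\<close> that(1,2), of "k y - k y'"])
      show "y - y' \<noteq> 0"
        using False by simp
      show "0 \<le> x \<bullet> (k y - k y')" if "x \<in> C" "0 < x \<bullet> (y - y')" for x
        using mono_k[of x y' y] that \<open>y \<in> Y\<close> \<open>y' \<in> Y\<close> by (simp add: inner_diff_right)
      show "x \<bullet> (k y - k y') \<le> 0" if "x \<in> C" "x \<bullet> (y - y') < 0" for x
        using mono_k[of x y y'] that \<open>y \<in> Y\<close> \<open>y' \<in> Y\<close> by (simp add: inner_diff_right)
    qed blast
  qed (auto intro: exI[of _ 0])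
  obtain r where r: "r > 0" "ball p r \<subseteq> C"
    using \<open>open C\<close> \<open>p \<in> C\<close> openE by blast
  have secant_ball: "\<exists>c\<ge>0. k y - k y' = c *\<^sub>R (y - y')"
    if "y \<in> Y" "y' \<in> Y" "y \<in> ball p r" "y' \<in> ball p r" for y y'
  proof (rule secant)
    \<comment> \<open>Two points of equal norm have a midpoint orthogonal to their difference, and
      the ball is convex.\<close>
    show "midpoint y y' \<in> C"
      using convexD[OF convex_ball that(3,4), of "1/2" "1/2"] r(2)
      by (auto simp: midpoint_def scaleR_add_right)
    show "midpoint y y' \<bullet> (y - y') = 0"
      using that by (simp add: midpoint_def inner_add inner_diff inner_commute dot_square_norm norm_eq_1_Y)
  qed (use that in auto)
  obtain y1 y2 where y12: "y1 \<in> Y" "y2 \<in> Y" "y1 \<noteq> y2" "y1 \<in> ball p r" "y2 \<in> ball p r"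
    using dense_in_sphere_two_points[OF dim Y_dense open_ball, of p p r] r(1) assms(3) by auto
  obtain c where c: "c \<ge> 0" "k y1 - k y2 = c *\<^sub>R (y1 - y2)"
    using secant_ball[of y1 y2] y12 by blast
  define d where "d = k y1 - c *\<^sub>R y1"
  define A where "A = {y \<in> Y. k y \<noteq> c *\<^sub>R y + d}"
  have "A = {}"
  proof (rule ccontr)
    assume "A \<noteq> {}"
    \<comment> \<open>With \<open>\<delta> \<le> r / 4\<close>, points of height above
      \<open>1 - 4 * \<delta>\<^sup>2\<close> lie in \<open>ball p r\<close>, and so does the
      reflection axis \<open>x\<close> at distance \<open>\<delta>\<close> from
      \<open>p\<close>.\<close>
    define \<delta> where "\<delta> = min (r / 4) (1 / 2)"
    have \<delta>: "0 < \<delta>" "\<delta> < 1" "\<delta> \<le> r / 4"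
      using r(1) by (auto simp: \<delta>_def)
    have A_far: "p \<bullet> z \<le> 1 - 4 * \<delta>\<^sup>2" if "z \<in> A" for z
    proof (rule ccontr)
      assume "\<not> ?thesis"
      moreover have "p \<bullet> p = 1" "z \<bullet> z = 1"
        using that assms(3) norm_eq_1_Y by (simp_all add: A_def dot_square_norm)
      then have "(norm (p - z))\<^sup>2 = 2 - 2 * (p \<bullet> z)"
        unfolding power2_norm_eq_inner by (simp add: inner_diff inner_commute)
      ultimately have "(norm (p - z))\<^sup>2 < 8 * \<delta>\<^sup>2"
        by simp
      also have "\<dots> \<le> 8 * (r / 4)\<^sup>2"
        using \<delta> by (intro mult_left_mono power_mono) auto
      also have "\<dots> \<le> r\<^sup>2"
        by (simp add: power2_eq_square)
      finally have "norm (p - z) < r"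
        using r(1) power2_less_imp_less by fastforce
      then have z: "z \<in> Y" "z \<in> ball p r"
        using that by (auto simp: A_def dist_norm)
      obtain c1 c2 where c12: "k z - k y1 = c1 *\<^sub>R (z - y1)" "k z - k y2 = c2 *\<^sub>R (z - y2)"
        using secant_ball z y12 by meson
      have "k z - k y1 = c *\<^sub>R (z - y1)"
        by (rule affine_on_sphere_third_point[where r = 1, OF _ _ _ y12(3) c(2) c12])
           (use y12 z in \<open>simp_all add: norm_eq_1_Y\<close>)
      then have "k z = c *\<^sub>R z + d"
        by (simp add: d_def algebra_simps)
      then show False
        using that by (simp add: A_def)
    qed
    define \<tau> where "\<tau> = Sup ((\<lambda>z. p \<bullet> z) ` A)"
    have bdd: "bdd_above ((\<lambda>z. p \<bullet> z) ` A)"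
      using A_far by (auto intro!: bdd_aboveI)
    have "\<tau> - \<delta>\<^sup>2 < \<tau>"
      using \<delta>(1) by simp
    \<comment> \<open>The height of \<open>z\<close> is within \<open>\<delta>\<^sup>2\<close> of
      the supremum, so the gain from reflection lifts it above every exceptional point.\<close>
    then obtain z where z: "z \<in> A" "\<tau> - \<delta>\<^sup>2 < p \<bullet> z"
      using less_cSup_iff[OF _ bdd, of "\<tau> - \<delta>\<^sup>2"] \<open>A \<noteq> {}\<close> by (auto simp: \<tau>_def)
    have nz: "norm z = 1" "z \<in> Y"
      using z(1) norm_eq_1_Y by (auto simp: A_def)
    obtain x where x: "x \<noteq> 0" "norm (x - p) = \<delta>"
      and closer: "p \<bullet> z + \<delta>\<^sup>2 \<le> p \<bullet> ((2 * (x \<bullet> z) / (x \<bullet> x)) *\<^sub>R x - z)"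
      using reflection_towards_pole[OF dim assms(3) nz(1) \<delta>(1,2) A_far[OF z(1)]] .
    define z' where "z' = (2 * (x \<bullet> z) / (x \<bullet> x)) *\<^sub>R x - z"
    have "x \<in> ball p r"
      using x(2) \<delta> r(1) by (simp add: dist_norm norm_minus_commute)
    then have "x \<in> C"
      using r(2) by blast
    have xz': "x \<bullet> (z - z') = 0"
      using x(1) by (simp add: z'_def inner_diff_right)
    have "z' \<bullet> z' = z \<bullet> z"
      using x(1) by (simp add: z'_def inner_diff inner_commute)
    then have nz': "norm z' = 1"
      using nz(1) by (simp add: norm_eq_sqrt_inner)
    have pz': "\<tau> < p \<bullet> z'"
      using closer z(2) by (simp add: z'_def)
    have "z' \<noteq> z"
      using closer \<delta>(1) by (auto simp flip: z'_def)
    \<comment> \<open>The reflected point \<open>z'\<close> need not belong to \<open>Y\<close>. For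
      \<open>y\<close> near \<open>z'\<close>, the projection \<open>q y\<close> of \<open>x\<close>
      orthogonal to \<open>z - y\<close> is close to \<open>q z' = x\<close>, hence still in
      \<open>C\<close>, and makes \<open>secant\<close> applicable to \<open>z\<close> and
      \<open>y\<close>.\<close>
    define q where "q = (\<lambda>y. x - (x \<bullet> (z - y) / ((z - y) \<bullet> (z - y))) *\<^sub>R (z - y))"
    have q_orth: "q y \<bullet> (z - y) = 0" if "y \<noteq> z" for y
      using that unfolding q_def inner_diff_left[of x] inner_scaleR_left by simp
    define V where "V = {y. \<tau> < p \<bullet> y} \<inter> (- {z} \<inter> q -` C)"
    have "continuous_on (- {z}) q"
      unfolding q_def by (intro continuous_intros) auto
    then have "open (- {z} \<inter> q -` C)"
      using \<open>open C\<close> by (intro continuous_open_preimage) auto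
    moreover have "open {y. \<tau> < p \<bullet> y}"
      by (intro open_Collect_less continuous_intros)
    ultimately have "open V"
      unfolding V_def by blast
    have "z' \<in> V"
      using pz' \<open>z' \<noteq> z\<close> \<open>x \<in> C\<close> by (simp add: V_def q_def xz')
    \<comment> \<open>Two points are needed: the secant between them has the known factor
      \<open>c\<close>, which the triangle with \<open>z\<close> passes on.\<close>
    obtain y y' where yy': "y \<in> Y" "y' \<in> Y" "y \<noteq> y'" "y \<in> V" "y' \<in> V"
      using dense_in_sphere_two_points[OF dim Y_dense \<open>open V\<close> \<open>z' \<in> V\<close> nz'] .
    have k_eq: "k u = c *\<^sub>R u + d" if "u \<in> Y" "u \<in> V" for u
    proof (rule ccontr)
      assume "k u \<noteq> c *\<^sub>R u + d"
      then have "p \<bullet> u \<le> \<tau>"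
        unfolding \<tau>_def using that by (intro cSup_upper bdd) (simp add: A_def)
      then show False
        using that by (simp add: V_def)
    qed
    have "\<exists>c1\<ge>0. k z - k u = c1 *\<^sub>R (z - u)" if "u \<in> Y" "u \<in> V" for u
      using that nz q_orth[of u] by (intro secant[of "q u"]) (auto simp: V_def)
    then obtain c1 c2 where c12: "k z - k y = c1 *\<^sub>R (z - y)" "k z - k y' = c2 *\<^sub>R (z - y')"
      using yy' by meson
    have cyy': "k y - k y' = c *\<^sub>R (y - y')"
      using k_eq yy' by (simp add: algebra_simps)
    have "k z - k y = c *\<^sub>R (z - y)"
      by (rule affine_on_sphere_third_point[where r = 1, OF _ _ _ yy'(3) cyy' c12])
         (use yy' nz in \<open>simp_all add: norm_eq_1_Y\<close>)
    then have "k z = c *\<^sub>R z + d"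
      using k_eq[of y] yy' by (simp add: algebra_simps)
    then show False
      using z(1) by (simp add: A_def)
  qed
  then show thesis
    using that[OF c(1), of d] by (auto simp: A_def)
qed

section \<open>Identification of the orthogonal transformation\<close>

theorem coincide_with_orthogonal_transformation:
  assumes "openin (top_of_set (sphere 0 1)) U" "U \<noteq> {}" "U \<subseteq> closure X"
  obtains T where "orthogonal_transformation T" "\<And>x. x \<in> X \<Longrightarrow> f x = T x" "\<And>y. y \<in> Y \<Longrightarrow> g y = T y"
proof -
  obtain p where p: "p \<in> U"
    using assms(2) by blast
  obtain O' where O': "open O'" "U = sphere 0 1 \<inter> O'"
    using assms(1) by (metis openin_open)
  \<comment> \<open>The open cone over \<open>U\<close>. It lies in \<open>span X\<close>, which
    therefore has nonempty interior and is the whole space.\<close>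
  define C where "C = - {0} \<inter> (\<lambda>x. x /\<^sub>R norm x) -` O'"
  have "continuous_on (- {0}) (\<lambda>x::'a. x /\<^sub>R norm x)"
    by (intro continuous_intros) auto
  then have "open C"
    using O'(1) unfolding C_def by (intro continuous_open_preimage) auto
  have C_iff: "x \<in> C \<longleftrightarrow> x /\<^sub>R norm x \<in> U \<and> x \<noteq> 0" for x
    by (auto simp: C_def O'(2))
  have np: "norm p = 1" and "p \<in> C"
    using p by (auto simp: C_def O'(2))
  have "C \<subseteq> span X"
  proof
    fix x assume "x \<in> C"
    then have "x /\<^sub>R norm x \<in> closure X" "x \<noteq> 0"
      using assms(3) C_iff by auto
    moreover have "closure X \<subseteq> span X"
      by (intro closure_minimal span_superset closed_span)
    ultimately have "x /\<^sub>R norm x \<in> span X"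
      by blast
    then have "norm x *\<^sub>R (x /\<^sub>R norm x) \<in> span X"
      by (rule span_scale)
    then show "x \<in> span X"
      using \<open>x \<noteq> 0\<close> by simp
  qed
  then have "interior (span X) \<noteq> {}"
    using \<open>open C\<close> \<open>p \<in> C\<close> interior_maximal by blast
  then have "\<not> dim X < DIM('a)"
    using empty_interior_lowdim[of "span X"] by (auto simp: dim_span)
  then have "span X = UNIV"
    by (intro subspace_dim_equal) auto
  then obtain B where B: "linear B" "inj B" "\<And>x. x \<in> X \<Longrightarrow> f x = weight x *\<^sub>R B x"
    using f_linear_up_to_weight by blast
  obtain c d where c: "0 \<le> c" and cd: "\<And>y. y \<in> Y \<Longrightarrow> adjoint B (g y) = c *\<^sub>R y + d"
    using affine_if_inner_weak_mono[OF \<open>open C\<close> \<open>p \<in> C\<close> np, of "\<lambda>y. adjoint B (g y)"]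
      inner_adjoint_weak_mono[OF B(1,3) assms(3)] C_iff by blast
  have lin_adj: "linear (adjoint B)"
    using B(1) by (rule adjoint_linear)
  have surj_B: "surj B"
    using B(1,2) linear_injective_imp_surjective by blast
  have "inj (adjoint B)"
    unfolding linear_injective_0[OF lin_adj]
  proof (intro allI impI)
    fix v assume "adjoint B v = 0"
    then have "B u \<bullet> v = 0" for u
      using adjoint_works[OF B(1), of u v] by simp
    then have "v \<bullet> v = 0"
      using surj_B by (metis surjD)
    then show "v = 0" by simp
  qed
  then obtain D where D: "linear D" "\<And>v. D (adjoint B v) = v" "\<And>v. adjoint B (D v) = v"
    using linear_injective_isomorphism[OF lin_adj] by metis
  define T where "T = (\<lambda>v. c *\<^sub>R D v)"
  have "linear T"
    unfolding T_def using D(1) by (rule linear_compose_scale_right)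
  have g_eq: "g y = T y + D d" if "y \<in> Y" for y
    using arg_cong[OF cd[OF that], of D]
    by (simp add: D(2) linear_add[OF D(1)] linear_scale[OF D(1)] T_def)
  \<comment> \<open>With \<open>c = 0\<close> the function \<open>g\<close> would be constant on
    \<open>Y\<close>, and its range could not be dense.\<close>
  have "c \<noteq> 0"
  proof
    assume "c = 0"
    then have "g ` Y \<subseteq> {D d}"
      using g_eq by (auto simp: T_def)
    then have "sphere 0 1 \<subseteq> {D d}"
      using gY_dense closure_minimal[of "g ` Y" "{D d}"] by blast
    moreover have "p \<in> sphere 0 1" "- p \<in> sphere 0 1"
      using np by simp_all
    ultimately have "p = D d" "- p = D d"
      by blast+
    then have "p \<bullet> p = p \<bullet> (- p)"
      by metis
    then show False
      using np by (simp add: dot_square_norm)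
  qed
  have "norm (T z + D d) = 1" if "norm z = 1" for z
  proof -
    have "closed {z. norm (T z + D d) = 1}"
      using \<open>linear T\<close>
      by (intro closed_Collect_eq continuous_intros linear_continuous_on) (simp add: linear_linear)
    moreover have "Y \<subseteq> {z. norm (T z + D d) = 1}"
      using g_eq norm_g by force
    ultimately have "closure Y \<subseteq> {z. norm (T z + D d) = 1}"
      by (rule closure_minimal[rotated])
    then show ?thesis
      using Y_dense that by auto
  qed
  moreover have "inj T"
    using \<open>c \<noteq> 0\<close> D(3) unfolding T_def inj_def by (metis scaleR_left_imp_eq)
  ultimately have T: "D d = 0" "orthogonal_transformation T"
    using affine_sphere_map_orthogonal[OF \<open>linear T\<close>] by blast+
  \<comment> \<open>\<open>adjoint B\<close> after \<open>T\<close> is \<open>c\<close> times the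
    identity and \<open>T\<close> preserves inner products, so the difference of the two sides,
    written as \<open>T w\<close>, is orthogonal to itself.\<close>
  have "B x = c *\<^sub>R T x" for x
  proof -
    obtain w where w: "T w = B x - c *\<^sub>R T x"
      using orthogonal_transformation_surj[OF T(2)] by (metis surjD)
    have "adjoint B (T w) = c *\<^sub>R w"
      by (simp add: T_def linear_scale[OF lin_adj] D(3))
    then have "B x \<bullet> T w = c * (x \<bullet> w)"
      using adjoint_works[OF B(1), of x "T w"] by simp
    moreover have "T x \<bullet> T w = x \<bullet> w"
      using T(2) by (simp add: orthogonal_transformation_def)
    ultimately have "(B x - c *\<^sub>R T x) \<bullet> T w = 0"
      by (simp add: inner_diff_left)
    then show ?thesis
      by (simp add: w)
  qed
  then have f_eq: "f x = (weight x * c) *\<^sub>R T x" if "x \<in> X" for x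
    using B(3)[OF that] by simp
  have "f x = T x" if "x \<in> X" for x
  proof -
    \<comment> \<open>The sign excludes the factor \<open>-1\<close> when norms are
      compared.\<close>
    have "0 \<le> weight x * c"
      using weight_pos[OF that] c by simp
    then have "weight x * c = 1"
      using arg_cong[OF f_eq[OF that], of norm] that
      by (simp add: norm_f norm_eq_1_X orthogonal_transformation_norm[OF T(2)])
    then show ?thesis
      using f_eq[OF that] by simp
  qed
  moreover have "g y = T y" if "y \<in> Y" for y
    using g_eq[OF that] T(1) by simp
  ultimately show thesis
    using that T(2) by blast
qed

end

section \<open>Compactness and passage to the limit\<close>

lemma pointwise_sequentially_compact_sphere:
  fixes F G :: "nat \<Rightarrow> real ^ 'p \<Rightarrow> real ^ 'p"
  assumes "countable X" "countable Y"
    and F: "\<And>a. a \<in> X \<Longrightarrow> \<forall>\<^sub>F n in sequentially. F n a \<in> unit_sphere"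
    and G: "\<And>b. b \<in> Y \<Longrightarrow> \<forall>\<^sub>F n in sequentially. G n b \<in> unit_sphere"
  shows "pointwise_sequentially_compact X Y F G"
  unfolding pointwise_sequentially_compact_def
proof (intro allI impI)
  fix r assume "subseq_indices r"
  then have "strict_mono r"
    by (simp add: subseq_indices_def)
  \<comment> \<open>Both sequences are joined into one on the disjoint sum, so that a single
    diagonal subsequence serves \<open>X\<close> and \<open>Y\<close> together.\<close>
  define H where "H = (\<lambda>n. case_sum (F (r n)) (G (r n)))"
  define S where "S = Inl ` X \<union> Inr ` Y"
  have H_sphere: "\<forall>\<^sub>F n in sequentially. H n s \<in> unit_sphere" if "s \<in> S" for s
    using that eventually_subseq[OF \<open>strict_mono r\<close> F] eventually_subseq[OF \<open>strict_mono r\<close> G]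
    by (auto simp: S_def H_def)
  text \<open>Truncation makes the sequence bounded from the first term on.\<close>
  define H' where "H' = (\<lambda>n s. if H n s \<in> unit_sphere then H n s else 0)"
  have "countable S"
    using assms(1,2) by (simp add: S_def)
  moreover have "norm (H' n s) \<le> 1" for n s
    by (simp add: H'_def)
  ultimately obtain k where k: "strict_mono k" "\<And>s. s \<in> S \<Longrightarrow> \<exists>l. (\<lambda>n. H' (k n) s) \<longlonglongrightarrow> l"
    using function_convergent_subsequence[of S H' 1] by metis
  have "\<exists>l. norm l = 1 \<and> (\<lambda>n. H (k n) s) \<longlonglongrightarrow> l" if "s \<in> S" for s
  proof -
    obtain l where l: "(\<lambda>n. H' (k n) s) \<longlonglongrightarrow> l"
      using k(2) \<open>s \<in> S\<close> by blast
    have ev: "\<forall>\<^sub>F n in sequentially. H (k n) s \<in> unit_sphere"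
      using eventually_subseq[OF k(1) H_sphere[OF \<open>s \<in> S\<close>]] .
    then have "(\<lambda>n. H (k n) s) \<longlonglongrightarrow> l"
      by (intro Lim_transform_eventually[OF l]) (auto elim!: eventually_mono simp: H'_def)
    moreover have "l \<in> unit_sphere"
      using Lim_in_closed_set[OF closed_sphere ev _ calculation] by simp
    ultimately show ?thesis by auto
  qed
  then obtain L where L: "\<And>s. s \<in> S \<Longrightarrow> norm (L s) = 1 \<and> (\<lambda>n. H (k n) s) \<longlonglongrightarrow> L s"
    by metis
  have "pointwise_convergent_to X Y (F \<circ> r \<circ> k) (G \<circ> r \<circ> k) (L \<circ> Inl) (L \<circ> Inr)"
    using L[of "Inl _"] L[of "Inr _"] by (auto simp: pointwise_convergent_to_def S_def H_def)
  moreover have "L \<circ> Inl \<in> X \<rightarrow> unit_sphere" "L \<circ> Inr \<in> Y \<rightarrow> unit_sphere"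
    using L by (auto simp: S_def)
  ultimately show "\<exists>s f g. strict_mono s \<and> f \<in> X \<rightarrow> unit_sphere \<and> g \<in> Y \<rightarrow> unit_sphere \<and>
      pointwise_convergent_to X Y (F \<circ> r \<circ> s) (G \<circ> r \<circ> s) f g"
    using k(1) by blast
qed

theorem theorem4p4:
  fixes x y :: "nat \<Rightarrow> real ^ 'p"
    and f_seq g_seq :: "nat \<Rightarrow> real ^ 'p \<Rightarrow> real ^ 'p"
  assumes "CARD('p) \<ge> 2"
    and "x ` {1..} \<subseteq> unit_sphere" and "inj_on x {1..}"
    and "y ` {1..} \<subseteq> unit_sphere" and "inj_on y {1..}"
    and "\<forall>n\<ge>1. f_seq n \<in> x ` {1..n} \<rightarrow> unit_sphere"
    and "\<forall>n\<ge>1. g_seq n \<in> y ` {1..n} \<rightarrow> unit_sphere"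
    and "\<forall>n\<ge>1. \<forall>a\<in>x ` {1..n}. \<forall>b\<in>y ` {1..n}. \<forall>b'\<in>y ` {1..n}.
           a \<bullet> b < a \<bullet> b' \<longrightarrow> f_seq n a \<bullet> g_seq n b \<le> f_seq n a \<bullet> g_seq n b'"
  shows "pointwise_sequentially_compact (x ` {1..}) (y ` {1..}) f_seq g_seq \<and>
    ((\<exists>U. open_in_sphere U \<and> U \<noteq> {} \<and> dense_in (x ` {1..}) U) \<and>
     dense_in (y ` {1..}) unit_sphere \<and>
     (CARD('p) = 2 \<longrightarrow>
       (\<exists>U. open_in_sphere U \<and> (\<exists>u\<in>unit_sphere. closed_hemisphere u \<subseteq> U) \<and>
            dense_in (x ` {1..}) U)) \<longrightarrow>
     (\<forall>f g. accumulation_point (x ` {1..}) (y ` {1..}) f_seq g_seq f g \<and>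
            dense_in (g ` (y ` {1..})) unit_sphere \<longrightarrow>
        (\<exists>T. orthogonal_transformation T \<and>
             (\<forall>a\<in>x ` {1..}. f a = T a) \<and> (\<forall>b\<in>y ` {1..}. g b = T b))))"
proof -
  let ?X = "x ` {1..}" and ?Y = "y ` {1..}"
  have seq_compact: "pointwise_sequentially_compact ?X ?Y f_seq g_seq"
  proof (rule pointwise_sequentially_compact_sphere)
    show "\<forall>\<^sub>F n in sequentially. f_seq n a \<in> unit_sphere" if a: "a \<in> ?X" for a
    proof -
      obtain i where "1 \<le> i" "a = x i" using a by auto
      then show ?thesis
        using assms(6) by (intro eventually_sequentiallyI[of i]) (auto simp: Pi_iff)
    qed
    show "\<forall>\<^sub>F n in sequentially. g_seq n b \<in> unit_sphere" if b: "b \<in> ?Y" for b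
    proof -
      obtain i where "1 \<le> i" "b = y i" using b by auto
      then show ?thesis
        using assms(7) by (intro eventually_sequentiallyI[of i]) (auto simp: Pi_iff)
    qed
  qed auto
  have rigid: "\<exists>T. orthogonal_transformation T \<and> (\<forall>a\<in>?X. f a = T a) \<and> (\<forall>b\<in>?Y. g b = T b)"
    if U: "open_in_sphere U" "U \<noteq> {}" "dense_in ?X U" and Y: "dense_in ?Y unit_sphere"
      and acc: "accumulation_point ?X ?Y f_seq g_seq f g" and gY: "dense_in (g ` ?Y) unit_sphere"
    for U f g
  proof -
    obtain r where r: "subseq_indices r"
      and conv: "\<And>a. a \<in> ?X \<Longrightarrow> (\<lambda>k. f_seq (r k) a) \<longlonglongrightarrow> f a"
        "\<And>b. b \<in> ?Y \<Longrightarrow> (\<lambda>k. g_seq (r k) b) \<longlonglongrightarrow> g b"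
      and maps: "f \<in> ?X \<rightarrow> unit_sphere" "g \<in> ?Y \<rightarrow> unit_sphere"
      using acc unfolding accumulation_point_def pointwise_convergent_to_def o_def by blast
    interpret weakly_monotone_pair ?X ?Y f g
    proof
      fix a b b'
      assume a: "a \<in> ?X" and b: "b \<in> ?Y" and b': "b' \<in> ?Y" and less: "a \<bullet> b < a \<bullet> b'"
      then obtain i j l where ijl: "a = x i" "b = y j" "b' = y l" "1 \<le> i" "1 \<le> j" "1 \<le> l"
        by auto
      \<comment> \<open>From this index on all three points lie in the domains, so the hypothesis
        applies to them.\<close>
      have "f_seq n a \<bullet> g_seq n b \<le> f_seq n a \<bullet> g_seq n b'" if "n \<ge> i + j + l" for n
      proof -
        have "a \<in> x ` {1..n}" "b \<in> y ` {1..n}" "b' \<in> y ` {1..n}" "1 \<le> n"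
          using ijl that by auto
        then show ?thesis
          using assms(8) less by blast
      qed
      then have "f_seq (r k) a \<bullet> g_seq (r k) b \<le> f_seq (r k) a \<bullet> g_seq (r k) b'" if "k \<ge> i + j + l" for k
        using that seq_suble[of r k] r by (force simp: subseq_indices_def)
      then show "f a \<bullet> g b \<le> f a \<bullet> g b'"
        by (intro LIMSEQ_le[OF tendsto_inner[OF conv(1)[OF a] conv(2)[OF b]]
              tendsto_inner[OF conv(1)[OF a] conv(2)[OF b']]]) blast
    qed (use assms Y gY maps in \<open>auto simp: dense_in_def\<close>)
    show ?thesis
      using coincide_with_orthogonal_transformation[of U] U
      unfolding open_in_sphere_def dense_in_def by metis
  qed
  from seq_compact rigid show ?thesis
    by blast
qed

end
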